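(* Let $(M,g)$ and $(M',g')$ be two Lorentzian manifolds and let $\gamma$ and $\gamma'$ be null geodesics in $M$ and $M'$ respectively. Let $f:M_\gamma\to M'_{\gamma'}$ be an isometry between tubular neighbourhoods of $\gamma$ and $\gamma'$ which maps $\gamma$ onto $\gamma'$. Then the Penrose limits of $(M,g)$ along $\gamma$ and of $(M',g')$ along $\gamma'$ are isometric.
   Context: Penrose limit: let $(M,g)$ be a Lorentzian manifold of dimension $n+1$ and $\gamma$ a null geodesic. Near any point of $\gamma$ there are adapted coordinates $(u,v,y^1,\dots,y^{n-1})$ in which $\gamma$ is $\{(u,0,0)\}$ and $g = du\,dv+\alpha\,dv^2+\sum_i\beta_i\,dy^i dv+\sum_{i,j}C_{ij}\,dy^i dy^j$, with $\alpha,\beta_i,C_{ij}$ functions of $(u,v,y)$ and $(C_{ij})$ positive definite. With $\phi_\Omega(u,v,y)=(u,\Omega^2 v,\Omega y)$, the Penrose limit along $\gamma$ is a tubular neighbourhood of $\gamma$ with the metric $g_{Pl}=\lim_{\Omega\to0}\Omega^{-2}\phi_\Omega^*g=du\,dv+\sum_{i,j}C_{ij}(u,0,0)\,dy^i dy^j$. It is regarded as independent of the adapted coordinates chosen, so that any adapted coordinates (on a suitable tubular neighbourhood) may be used to compute it. *)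

theory Defs
  imports "HOL-Analysis.Analysis"
begin

section \<open>Smooth maps on open subsets of Euclidean spaces\<close>

fun Ck_on :: "nat \<Rightarrow> ('a::euclidean_space \<Rightarrow> 'b::real_normed_vector) \<Rightarrow> 'a set \<Rightarrow> bool" where
  "Ck_on 0 f S \<longleftrightarrow> continuous_on S f"
| "Ck_on (Suc k) f S \<longleftrightarrow> (\<forall>x\<in>S. f differentiable (at x)) \<and>
     (\<forall>b\<in>Basis. Ck_on k (\<lambda>x. frechet_derivative f (at x) b) S)"

definition smooth_on :: "'a::euclidean_space set \<Rightarrow> ('a \<Rightarrow> 'b::real_normed_vector) \<Rightarrow> bool" where
  "smooth_on S f \<longleftrightarrow> (\<forall>k. Ck_on k f S)"

text \<open>Component matrix at \<open>q\<close> of the pullback along \<open>\<tau>\<close> of the bilinear form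
  field with component matrices \<open>G\<close>.\<close>

definition pullback ::
  "(real^'n \<Rightarrow> real^'n) \<Rightarrow> (real^'n \<Rightarrow> real^'n^'n) \<Rightarrow> real^'n \<Rightarrow> real^'n^'n" where
  "pullback \<tau> G q =
     (let J = matrix (frechet_derivative \<tau> (at q)) in transpose J ** G (\<tau> q) ** J)"


section \<open>Lorentzian manifolds\<close>

text \<open>A chart is a pair \<open>(W, x)\<close> of a domain and a coordinate map; the values of \<open>x\<close> outside
  \<open>W\<close> are irrelevant. The coordinate space \<open>real^'n\<close> fixes the dimension \<open>CARD('n)\<close>.\<close>

type_synonym ('a, 'n) chart = "'a set \<times> ('a \<Rightarrow> real^'n)"

text \<open>A metric is given classically, by its component matrix in every chart, as a function on
  the image of that chart.\<close>

record ('a, 'n) metric_manifold =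
  top_of :: "'a topology"
  atlas :: "('a, 'n::finite) chart set"
  metric :: "('a, 'n::finite) chart \<Rightarrow> real^'n \<Rightarrow> real^'n^'n"

definition is_chart :: "'a topology \<Rightarrow> ('a, 'n::finite) chart \<Rightarrow> bool" where
  "is_chart X = (\<lambda>(W, x). openin X W \<and> open (x ` W) \<and>
     homeomorphic_map (subtopology X W) (top_of_set (x ` W)) x)"

definition smooth_transition :: "('a, 'n::finite) chart \<Rightarrow> ('a, 'n) chart \<Rightarrow> bool" where
  "smooth_transition = (\<lambda>(W, x) (W', x'). smooth_on (x ` (W \<inter> W')) (x' \<circ> inv_into W x))"

definition compatible :: "('a, 'n::finite) chart \<Rightarrow> ('a, 'n) chart \<Rightarrow> bool" where
  "compatible c d \<longleftrightarrow> smooth_transition c d \<and> smooth_transition d c"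

text \<open>The smooth structure is a maximal atlas, so that \<open>c \<in> atlas M\<close> ranges over all local
  coordinate systems of \<open>M\<close>.\<close>

definition smooth_manifold :: "('a, 'n::finite) metric_manifold \<Rightarrow> bool" where
  "smooth_manifold M \<longleftrightarrow>
     Hausdorff_space (top_of M) \<and> second_countable (top_of M) \<and>
     \<Union> (fst ` atlas M) = topspace (top_of M) \<and>
     (\<forall>c\<in>atlas M. is_chart (top_of M) c) \<and>
     (\<forall>c\<in>atlas M. \<forall>d\<in>atlas M. compatible c d) \<and>
     (\<forall>c. is_chart (top_of M) c \<and> (\<forall>d\<in>atlas M. compatible c d) \<longrightarrow> c \<in> atlas M)"

definition minkowski :: "'n::finite \<Rightarrow> real^'n^'n" where
  "minkowski k = (\<chi> i j. if i = j then (if i = k then - 1 else 1) else 0)"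

definition lorentzian_form :: "real^'n::finite^'n \<Rightarrow> bool" where
  "lorentzian_form A \<longleftrightarrow> (\<exists>(P :: real^'n^'n) k. invertible P \<and> transpose P ** A ** P = minkowski k)"

definition lorentzian_manifold :: "('a, 'n::finite) metric_manifold \<Rightarrow> bool" where
  "lorentzian_manifold M \<longleftrightarrow> smooth_manifold M \<and> 2 \<le> CARD('n) \<and>
     (\<forall>(W, x)\<in>atlas M. smooth_on (x ` W) (metric M (W, x)) \<and>
        (\<forall>q\<in>x ` W. lorentzian_form (metric M (W, x) q))) \<and>
     (\<forall>(W, x)\<in>atlas M. \<forall>(W', x')\<in>atlas M. \<forall>q\<in>x ` (W \<inter> W').
        metric M (W, x) q = pullback (x' \<circ> inv_into W x) (metric M (W', x')) q)"

definition open_submanifold ::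
  "('a, 'n::finite) metric_manifold \<Rightarrow> 'a set \<Rightarrow> ('a, 'n) metric_manifold" where
  "open_submanifold M S =
     \<lparr>top_of = subtopology (top_of M) S, atlas = {c \<in> atlas M. fst c \<subseteq> S}, metric = metric M\<rparr>"

text \<open>An open subset \<open>N\<close> of \<open>real^'n\<close> with the metric whose matrix in the standard
  coordinates is \<open>h\<close>.\<close>

definition coordinate_manifold ::
  "(real^'n) set \<Rightarrow> (real^'n \<Rightarrow> real^'n^'n) \<Rightarrow> (real^'n, 'n::finite) metric_manifold" where
  "coordinate_manifold N h =
     \<lparr>top_of = top_of_set N,
      atlas = {(W, x). is_chart (top_of_set N) (W, x) \<and>
                 smooth_on W x \<and> smooth_on (x ` W) (inv_into W x)},
      metric = (\<lambda>(W, x). pullback (inv_into W x) h)\<rparr>"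

definition isometry ::
  "('a, 'n::finite) metric_manifold \<Rightarrow> ('b, 'n) metric_manifold \<Rightarrow> ('a \<Rightarrow> 'b) \<Rightarrow> bool" where
  "isometry M M' f \<longleftrightarrow>
     homeomorphic_map (top_of M) (top_of M') f \<and>
     (\<forall>(W, x)\<in>atlas M. \<forall>(W', x')\<in>atlas M'.
        smooth_on (x ` (W \<inter> f -` W')) (x' \<circ> f \<circ> inv_into W x) \<and>
        smooth_on (x' ` (f ` W \<inter> W')) (x \<circ> inv_into (topspace (top_of M)) f \<circ> inv_into W' x') \<and>
        (\<forall>q\<in>x ` (W \<inter> f -` W').
           metric M (W, x) q = pullback (x' \<circ> f \<circ> inv_into W x) (metric M' (W', x')) q))"

definition isometric ::
  "('a, 'n::finite) metric_manifold \<Rightarrow> ('b, 'n) metric_manifold \<Rightarrow> bool" where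
  "isometric M M' \<longleftrightarrow> (\<exists>f. isometry M M' f)"


section \<open>Null geodesics and tubular neighbourhoods\<close>

definition christoffel ::
  "(real^'n \<Rightarrow> real^'n^'n) \<Rightarrow> real^'n \<Rightarrow> 'n::finite \<Rightarrow> 'n \<Rightarrow> 'n \<Rightarrow> real" where
  "christoffel G q k i j =
     (let D = (\<lambda>a b c. frechet_derivative (\<lambda>p. G p $ b $ c) (at q) (axis a 1)) in
      (\<Sum>l\<in>UNIV. matrix_inv (G q) $ k $ l * (D i j l + D j i l - D l i j)) / 2)"

definition null_geodesic ::
  "('a, 'n::finite) metric_manifold \<Rightarrow> (real \<Rightarrow> 'a) \<Rightarrow> real set \<Rightarrow> bool" where
  "null_geodesic M \<gamma> I \<longleftrightarrow>
     open I \<and> is_interval I \<and> I \<noteq> {} \<and>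
     continuous_map (top_of_set I) (top_of M) \<gamma> \<and>
     (\<forall>(W, x)\<in>atlas M.
        smooth_on {s\<in>I. \<gamma> s \<in> W} (x \<circ> \<gamma>) \<and>
        (\<forall>s\<in>I. \<gamma> s \<in> W \<longrightarrow>
          (let G = metric M (W, x); q = x (\<gamma> s);
               w = (\<lambda>t. vector_derivative (x \<circ> \<gamma>) (at t));
               a = vector_derivative w (at s)
           in w s \<noteq> 0 \<and> w s \<bullet> (G q *v w s) = 0 \<and>
              (\<forall>k. a $ k + (\<Sum>i\<in>UNIV. \<Sum>j\<in>UNIV.
                       christoffel G q k i j * w s $ i * w s $ j) = 0))))"

text \<open>The normal bundle of a curve parametrised by an interval \<open>I\<close> is trivial, so a tubular
  neighbourhood is a copy of \<open>I\<close> times a Euclidean space, the zero section being the curve.\<close>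

definition tubular_neighbourhood ::
  "('a, 'n::finite) metric_manifold \<Rightarrow> (real \<Rightarrow> 'a) \<Rightarrow> real set \<Rightarrow> 'a set \<Rightarrow> bool" where
  "tubular_neighbourhood M \<gamma> I T \<longleftrightarrow>
     (\<exists>x k. (T, x) \<in> atlas M \<and> x ` T = {q. q $ k \<in> I} \<and>
        (\<forall>s\<in>I. \<gamma> s \<in> T \<and> x (\<gamma> s) = axis k s))"


section \<open>Adapted coordinates and the Penrose limit\<close>

text \<open>Two distinct indices \<open>u\<close> and \<open>v\<close> label the coordinates of these names; the
  remaining \<open>CARD('n) - 2\<close> indices label the coordinates \<open>y\<close>. Then \<open>axis u s\<close> is the
  point \<open>(s, 0, 0)\<close>.\<close>

definition adapted_form :: "'n::finite \<Rightarrow> 'n \<Rightarrow> (real^'n) set \<Rightarrow> (real^'n \<Rightarrow> real^'n^'n) \<Rightarrow> bool" where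
  "adapted_form u v U G \<longleftrightarrow>
     (\<exists>(\<alpha> :: real^'n \<Rightarrow> real) (\<beta> :: 'n \<Rightarrow> real^'n \<Rightarrow> real) (C :: 'n \<Rightarrow> 'n \<Rightarrow> real^'n \<Rightarrow> real).
       let Y = - {u, v} in
       \<forall>q\<in>U.
         (\<forall>w. w \<bullet> (G q *v w) =
            w $ u * w $ v + \<alpha> q * (w $ v)\<^sup>2 + (\<Sum>i\<in>Y. \<beta> i q * w $ i * w $ v)
              + (\<Sum>i\<in>Y. \<Sum>j\<in>Y. C i j q * w $ i * w $ j)) \<and>
         (\<forall>i\<in>Y. \<forall>j\<in>Y. C i j q = C j i q) \<and>
         (\<forall>w::real^'n. (\<exists>i\<in>Y. w $ i \<noteq> 0) \<longrightarrow>
            (\<Sum>i\<in>Y. \<Sum>j\<in>Y. C i j q * w $ i * w $ j) > 0))"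

text \<open>The chart need not cover all of the curve (in general this is impossible, because of focal points): it is
  adapted to the segment of the curve contained in its domain.\<close>

definition adapted_chart ::
  "('a, 'n::finite) metric_manifold \<Rightarrow> (real \<Rightarrow> 'a) \<Rightarrow> real set \<Rightarrow> 'n \<Rightarrow> 'n \<Rightarrow> ('a, 'n) chart \<Rightarrow> bool"
  where
  "adapted_chart M \<gamma> I u v = (\<lambda>(W, x).
     (W, x) \<in> atlas M \<and> u \<noteq> v \<and>
     {s. axis u s \<in> x ` W} \<noteq> {} \<and> is_interval {s. axis u s \<in> x ` W} \<and>
     x ` (\<gamma> ` I \<inter> W) = x ` W \<inter> range (axis u) \<and>
     adapted_form u v (x ` W) (metric M (W, x)))"

definition penrose_scaling :: "'n::finite \<Rightarrow> 'n \<Rightarrow> real \<Rightarrow> real^'n \<Rightarrow> real^'n" where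
  "penrose_scaling u v \<Omega> q =
     (\<chi> i. if i = u then q $ i else if i = v then \<Omega>\<^sup>2 * q $ i else \<Omega> * q $ i)"

definition penrose_metric ::
  "'n::finite \<Rightarrow> 'n \<Rightarrow> (real^'n \<Rightarrow> real^'n^'n) \<Rightarrow> real^'n \<Rightarrow> real^'n^'n" where
  "penrose_metric u v G q =
     Lim (at_right 0) (\<lambda>\<Omega>. (1 / \<Omega>\<^sup>2) *\<^sub>R pullback (penrose_scaling u v \<Omega>) G q)"

text \<open>For a symmetric metric in adapted form the limit exists and is
  \<open>du dv + \<Sum> C\<^sub>i\<^sub>j(u, 0, 0) dy\<^sup>i dy\<^sup>j\<close>, where \<open>C\<^sub>i\<^sub>j\<close> is the block of \<open>G\<close> with indices
  outside \<open>{u, v}\<close>.\<close>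

lemma matrix_penrose_scaling:
  fixes u v :: "'n::finite"
  shows "matrix (frechet_derivative (penrose_scaling u v \<Omega>) (at q)) =
     (\<chi> i j. if i = j then (if i = u then 1 else if i = v then \<Omega>\<^sup>2 else \<Omega>) else 0)"
proof -
  have lin: "linear (penrose_scaling u v \<Omega> :: real^'n \<Rightarrow> real^'n)"
    by (rule linearI) (auto simp: penrose_scaling_def vec_eq_iff algebra_simps)
  then have "(penrose_scaling u v \<Omega> has_derivative penrose_scaling u v \<Omega>) (at q)"
    by (intro bounded_linear_imp_has_derivative linear_conv_bounded_linear[THEN iffD1])
  then have "frechet_derivative (penrose_scaling u v \<Omega>) (at q) = penrose_scaling u v \<Omega>"
    by (metis frechet_derivative_at)
  then show ?thesis
    by (auto simp: matrix_def penrose_scaling_def vec_eq_iff axis_def)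
qed

lemma pullback_penrose_scaling:
  fixes G :: "real^'n \<Rightarrow> real^'n^'n" and u v :: 'n
  defines "c \<equiv> \<lambda>\<Omega>::real. \<lambda>i. if i = u then 1 else if i = v then \<Omega>\<^sup>2 else \<Omega>"
  shows "pullback (penrose_scaling u v \<Omega>) G q $ i $ j =
     c \<Omega> i * c \<Omega> j * G (penrose_scaling u v \<Omega> q) $ i $ j"
proof -
  have J: "matrix (frechet_derivative (penrose_scaling u v \<Omega>) (at q)) =
     (\<chi> i j. if i = j then c \<Omega> i else 0)"
    by (simp add: matrix_penrose_scaling c_def vec_eq_iff)
  show ?thesis
    unfolding pullback_def Let_def J
    by (simp add: matrix_matrix_mult_def transpose_def if_distrib if_distribR cong: if_cong)
qed

lemma quadratic_form_axis:
  fixes A :: "real^'n^'n"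
  shows "(a *\<^sub>R axis i 1 + b *\<^sub>R axis j 1) \<bullet> (A *v (a *\<^sub>R axis i 1 + b *\<^sub>R axis j 1)) =
     a\<^sup>2 * A $ i $ i + a * b * (A $ i $ j + A $ j $ i) + b\<^sup>2 * A $ j $ j"
proof -
  have *: "axis k 1 \<bullet> (A *v axis l 1) = A $ k $ l" for k l
    by (simp add: inner_axis' matrix_vector_mult_basis column_def)
  show ?thesis
    by (simp add: matrix_vector_right_distrib matrix_vector_mult_scaleR inner_add_left
        inner_add_right * power2_eq_square algebra_simps)
qed

lemma adapted_form_components:
  fixes G :: "real^'n \<Rightarrow> real^'n^'n"
  assumes "adapted_form u v U G" and "u \<noteq> v" and "q \<in> U" and sym: "transpose (G q) = G q"
  shows "G q $ u $ u = 0" and "G q $ u $ v = 1 / 2" and "G q $ v $ u = 1 / 2"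
    and "i \<notin> {u, v} \<Longrightarrow> G q $ u $ i = 0" and "i \<notin> {u, v} \<Longrightarrow> G q $ i $ u = 0"
proof -
  obtain \<alpha> \<beta> C where "\<forall>q\<in>U. (\<forall>w. w \<bullet> (G q *v w) =
            w $ u * w $ v + \<alpha> q * (w $ v)\<^sup>2 + (\<Sum>i\<in>-{u,v}. \<beta> i q * w $ i * w $ v)
              + (\<Sum>i\<in>-{u,v}. \<Sum>j\<in>-{u,v}. C i j q * w $ i * w $ j))"
    using assms(1) unfolding adapted_form_def Let_def by fast
  then have F: "w \<bullet> (G q *v w) =
            w $ u * w $ v + \<alpha> q * (w $ v)\<^sup>2 + (\<Sum>i\<in>-{u,v}. \<beta> i q * w $ i * w $ v)
              + (\<Sum>i\<in>-{u,v}. \<Sum>j\<in>-{u,v}. C i j q * w $ i * w $ j)" for w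
    using \<open>q \<in> U\<close> by blast
  have s: "G q $ a $ b = G q $ b $ a" for a b
    using arg_cong[OF sym, of "\<lambda>A. A $ b $ a"] by (simp add: transpose_def)
  have sum0: "(\<Sum>i\<in>-{u,v}. \<beta> i q * w $ i * w $ v) = 0"
      "(\<Sum>i\<in>-{u,v}. \<Sum>j\<in>-{u,v}. C i j q * w $ i * w $ j) = 0"
    if "\<And>i. i \<notin> {u, v} \<Longrightarrow> w $ i = 0" for w :: "real^'n"
    using that by (auto intro!: sum.neutral)
  have Fuv: "w \<bullet> (G q *v w) = w $ u * w $ v + \<alpha> q * (w $ v)\<^sup>2"
    if "\<And>i. i \<notin> {u, v} \<Longrightarrow> w $ i = 0" for w
    using F[of w] sum0[of w] that by simp
  have "(1 *\<^sub>R axis u 1 + 0 *\<^sub>R axis v 1) \<bullet> (G q *v (1 *\<^sub>R axis u 1 + 0 *\<^sub>R axis v 1)) = 0"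
    using \<open>u \<noteq> v\<close> by (subst Fuv) (simp_all add: axis_def)
  then show uu: "G q $ u $ u = 0"
    unfolding quadratic_form_axis by simp
  have "(0 *\<^sub>R axis u 1 + 1 *\<^sub>R axis v 1) \<bullet> (G q *v (0 *\<^sub>R axis u 1 + 1 *\<^sub>R axis v 1)) = \<alpha> q"
    using \<open>u \<noteq> v\<close> by (subst Fuv) (simp_all add: axis_def)
  then have vv: "G q $ v $ v = \<alpha> q"
    unfolding quadratic_form_axis by simp
  have "(1 *\<^sub>R axis u 1 + 1 *\<^sub>R axis v 1) \<bullet> (G q *v (1 *\<^sub>R axis u 1 + 1 *\<^sub>R axis v 1)) = 1 + \<alpha> q"
    using \<open>u \<noteq> v\<close> by (subst Fuv) (simp_all add: axis_def)
  then show uv: "G q $ u $ v = 1 / 2"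
    unfolding quadratic_form_axis using uu vv s[of v u] by simp
  then show "G q $ v $ u = 1 / 2"
    using s[of v u] by simp
  show ui: "G q $ u $ i = 0" if i: "i \<notin> {u, v}"
  proof -
    define w where "w = (\<lambda>a. a *\<^sub>R axis u 1 + 1 *\<^sub>R axis i (1::real))"
    have v0: "w a $ v = 0" for a
      using i \<open>u \<noteq> v\<close> by (auto simp: w_def axis_def)
    have y: "w a $ k = axis i 1 $ k" if "k \<in> - {u, v}" for a k
      using that by (simp add: w_def axis_def)
    have "w a \<bullet> (G q *v w a) =
        (\<Sum>k\<in>-{u,v}. \<Sum>l\<in>-{u,v}. C k l q * axis i 1 $ k * axis i 1 $ l)" for a
      unfolding F[of "w a"] v0 by (simp add: y)
    then have "w 1 \<bullet> (G q *v w 1) = w 0 \<bullet> (G q *v w 0)"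
      by simp
    then show ?thesis
      unfolding w_def quadratic_form_axis using uu s[of i u] by simp
  qed
  show "G q $ i $ u = 0" if "i \<notin> {u, v}"
    using ui[OF that] s[of i u] by simp
qed

lemma penrose_metric_adapted:
  fixes G :: "real^'n \<Rightarrow> real^'n^'n"
  assumes ad: "adapted_form u v U G" and uv: "u \<noteq> v" and "open U" and "continuous_on U G"
    and sym: "\<And>p. p \<in> U \<Longrightarrow> transpose (G p) = G p" and q: "axis u (q $ u) \<in> U"
  shows "penrose_metric u v G q =
     (\<chi> i j. if {i, j} = {u, v} then 1 / 2
             else if i \<in> {u, v} \<or> j \<in> {u, v} then 0 else G (axis u (q $ u)) $ i $ j)"
    (is "_ = ?R")
proof -
  let ?\<phi> = "\<lambda>\<Omega>. penrose_scaling u v \<Omega> q"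
  let ?F = "\<lambda>\<Omega>. (1 / \<Omega>\<^sup>2) *\<^sub>R pullback (penrose_scaling u v \<Omega>) G q"
  have "((\<lambda>\<Omega>. ?\<phi> \<Omega> $ i) \<longlongrightarrow> axis u (q $ u) $ i) (at_right 0)" for i
    by (cases "i = u"; cases "i = v")
       (auto simp: penrose_scaling_def axis_def intro!: tendsto_eq_intros)
  then have lim: "(?\<phi> \<longlongrightarrow> axis u (q $ u)) (at_right 0)"
    by (rule vec_tendstoI)
  have G: "((\<lambda>\<Omega>. G (?\<phi> \<Omega>)) \<longlongrightarrow> G (axis u (q $ u))) (at_right 0)"
    using assms(3,4) q lim
    by (metis continuous_on_eq_continuous_at isCont_tendsto_compose)
  have ev: "\<forall>\<^sub>F \<Omega> in at_right 0. ?\<phi> \<Omega> \<in> U \<and> \<Omega> > 0"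
    using topological_tendstoD[OF lim \<open>open U\<close> q] eventually_at_right_less[of "0::real"]
    by eventually_elim auto
  have "((\<lambda>\<Omega>. ?F \<Omega> $ i $ j) \<longlongrightarrow> ?R $ i $ j) (at_right 0)" for i j
  proof -
    define c :: "real \<Rightarrow> real"
      where "c = (\<lambda>\<Omega>. if i = v \<and> j = v then \<Omega>\<^sup>2 else if i = v \<or> j = v then \<Omega> else 1)"
    define H where "H = (\<lambda>\<Omega>. if {i, j} = {u, v} then 1 / 2 else if i = u \<or> j = u then 0
          else c \<Omega> * G (?\<phi> \<Omega>) $ i $ j)"
    have "\<forall>\<^sub>F \<Omega> in at_right 0. H \<Omega> = ?F \<Omega> $ i $ j"
      using ev
    proof eventually_elim
      case (elim \<Omega>)
      note K = adapted_form_components[OF ad uv conjunct1[OF elim] sym[OF conjunct1[OF elim]]]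
      show ?case
        using elim uv K(1-3) K(4)[of j] K(5)[of i]
        by (auto simp: H_def c_def pullback_penrose_scaling power2_eq_square field_simps
            doubleton_eq_iff split: if_splits)
    qed
    moreover have "(H \<longlongrightarrow> ?R $ i $ j) (at_right 0)"
    proof -
      have Gij: "((\<lambda>\<Omega>. G (?\<phi> \<Omega>) $ i $ j) \<longlongrightarrow> G (axis u (q $ u)) $ i $ j) (at_right 0)"
        by (intro tendsto_vec_nth G)
      have "(c \<longlongrightarrow> (if i = v \<or> j = v then 0 else 1)) (at_right 0)"
        unfolding c_def
        by (cases "i = v"; cases "j = v") (auto intro!: tendsto_eq_intros)
      from tendsto_mult[OF this Gij] show ?thesis
        unfolding H_def using uv
        by (cases "{i, j} = {u, v}"; cases "i = u \<or> j = u"; cases "i = v \<or> j = v") force+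
    qed
    ultimately show ?thesis
      by (simp only: tendsto_cong)
  qed
  then have "(?F \<longlongrightarrow> ?R) (at_right 0)"
    by (intro vec_tendstoI)
  then show ?thesis
    unfolding penrose_metric_def by (intro tendsto_Lim) auto
qed

text \<open>The underlying tubular neighbourhood is the largest set on which the limit is defined: all
  \<open>(s, v, y)\<close> with \<open>(s, 0, 0)\<close> in the image of the chart.\<close>

definition penrose_limit ::
  "('a, 'n::finite) metric_manifold \<Rightarrow> 'n \<Rightarrow> 'n \<Rightarrow> ('a, 'n) chart \<Rightarrow> (real^'n, 'n) metric_manifold"
  where
  "penrose_limit M u v = (\<lambda>(W, x).
     coordinate_manifold {q. axis u (q $ u) \<in> x ` W} (penrose_metric u v (metric M (W, x))))"

end

theory Submission
  imports Defs
begin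

text \<open>In adapted coordinates the isometry is a smooth map \<open>F\<close> that preserves the curve, and
  \<open>\<phi>\<^sub>\<Omega>\<inverse> \<circ> F \<circ> \<phi>\<^sub>\<Omega>\<close> is an isometry between the rescaled metrics for every \<open>\<Omega> > 0\<close>. Since \<open>F\<close>
  is an isometry of metrics in adapted form, the derivatives of its \<open>v\<close>-component in the directions
  \<open>u\<close> and \<open>y\<close> vanish along the curve. Hence, by Taylor expansion, these maps and their first
  derivatives converge as \<open>\<Omega> \<rightarrow> 0\<close>, and the isometry identity passes to the limit.\<close>

section \<open>Calculus of smooth maps\<close>

text \<open>The adapted charts on the two sides are chosen independently, so \<open>F\<close> is a
  general change of coordinates. Conjugation by the scaling multiplies the Jacobian entry in row i,
  column j by a quotient of weights, the weights of u, v, y being 1,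
  \<open>\<Omega>\<^sup>2\<close>, \<Omega>. The entries (y,u) and (v,y) are thus divided by
  \<Omega>, and (v,u) by \<open>\<Omega>\<^sup>2\<close>. For the last one, vanishing along the
  curve is not enough: the y-derivatives of the u-derivative of the v-component must vanish there as
  well. They do, because the y-derivatives of that component are zero along the whole curve and
  mixed partials commute; this is where the symmetry of second derivatives enters. Limits and
  derivatives are never interchanged. The limit map \<open>\<Phi>\<close> is written down, its
  Jacobian is computed explicitly, and the rescaled Jacobians are shown to converge to it at each
  fixed point; uniqueness of limits then gives the metric identity. The inverse
  \<open>\<Psi>\<close> is explicit too: over each u, \<open>\<Phi>\<close> is linear in y and
  affine in v, up to a shift of v quadratic in y.\<close>

lemma frechet_derivative_apply:
  "(f has_derivative D) (at x) \<Longrightarrow> frechet_derivative f (at x) b = D b"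
  using frechet_derivative_at[of f D x] by simp

lemma Ck_on_Suc_imp: "Ck_on (Suc k) f S \<Longrightarrow> Ck_on k f S"
proof (induction k arbitrary: f)
  case 0
  then show ?case
    by (auto intro!: continuous_at_imp_continuous_on differentiable_imp_continuous_within)
next
  case (Suc k)
  then show ?case by simp
qed

lemma Ck_on_subset: "Ck_on k f S \<Longrightarrow> T \<subseteq> S \<Longrightarrow> Ck_on k f T"
  by (induction k arbitrary: f) (auto intro: continuous_on_subset)

lemma differentiable_at_cong:
  assumes "open S" "x \<in> S" "\<And>y. y \<in> S \<Longrightarrow> f y = g y"
  shows "f differentiable (at x) \<longleftrightarrow> g differentiable (at x)"
  using assms has_derivative_transform_within_open[of f _ x UNIV S g]
    has_derivative_transform_within_open[of g _ x UNIV S f]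
  by (auto simp: differentiable_def)

lemma frechet_derivative_cong_open:
  assumes "open S" "x \<in> S" "\<And>y. y \<in> S \<Longrightarrow> f y = g y"
  shows "frechet_derivative f (at x) = frechet_derivative g (at x)"
proof -
  have "(f has_derivative D) (at x) \<longleftrightarrow> (g has_derivative D) (at x)" for D
    using assms has_derivative_transform_within_open[of f D x UNIV S g]
      has_derivative_transform_within_open[of g D x UNIV S f] by auto
  then show ?thesis by (simp add: frechet_derivative_def)
qed

text \<open>Openness is essential: \<open>frechet_derivative\<close> at a point depends on the
  values in a whole neighbourhood.\<close>

lemma Ck_on_cong:
  assumes "open S" "\<And>x. x \<in> S \<Longrightarrow> f x = g x"
  shows "Ck_on k f S \<longleftrightarrow> Ck_on k g S"
  using assms(2)
proof (induction k arbitrary: f g)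
  case 0
  then show ?case by (auto intro: continuous_on_cong[THEN iffD1])
next
  case (Suc k)
  have "Ck_on k (\<lambda>x. frechet_derivative f (at x) b) S \<longleftrightarrow>
      Ck_on k (\<lambda>x. frechet_derivative g (at x) b) S" for b
    by (rule Suc.IH) (metis frechet_derivative_cong_open[OF assms(1)] Suc.prems)
  then show ?case
    using differentiable_at_cong[OF assms(1) _ Suc.prems] by simp
qed

lemma Ck_on_const: "Ck_on k (\<lambda>x. c) S"
  by (induction k arbitrary: c) auto

lemma Ck_on_add:
  assumes "open S" "Ck_on k f S" "Ck_on k g S"
  shows "Ck_on k (\<lambda>x. f x + g x) S"
  using assms(2,3)
proof (induction k arbitrary: f g)
  case 0
  then show ?case by (simp add: continuous_on_add)
next
  case (Suc k)
  have D: "frechet_derivative (\<lambda>x. f x + g x) (at x) b =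
      frechet_derivative f (at x) b + frechet_derivative g (at x) b" if "x \<in> S" for x b
  proof -
    have "((\<lambda>x. f x + g x) has_derivative (\<lambda>b. frechet_derivative f (at x) b +
        frechet_derivative g (at x) b)) (at x)"
      using Suc.prems that
      by (intro has_derivative_add frechet_derivative_works[THEN iffD1]) auto
    then show ?thesis by (rule frechet_derivative_apply)
  qed
  have "Ck_on k (\<lambda>x. frechet_derivative (\<lambda>x. f x + g x) (at x) b) S" if "b \<in> Basis" for b
    by (subst Ck_on_cong[OF assms(1) D]) (use Suc that in auto)
  then show ?case using Suc.prems by simp
qed

lemma Ck_on_scaleR:
  assumes "open S" "Ck_on k f S" "Ck_on k g S"
  shows "Ck_on k (\<lambda>x. f x *\<^sub>R g x) S"
  using assms(2,3)
proof (induction k arbitrary: f g)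
  case 0
  then show ?case by (simp add: continuous_on_scaleR)
next
  case (Suc k)
  have D: "frechet_derivative (\<lambda>x. f x *\<^sub>R g x) (at x) b =
      f x *\<^sub>R frechet_derivative g (at x) b + frechet_derivative f (at x) b *\<^sub>R g x" if "x \<in> S" for x b
  proof -
    have "((\<lambda>x. f x *\<^sub>R g x) has_derivative (\<lambda>b. f x *\<^sub>R frechet_derivative g (at x) b +
        frechet_derivative f (at x) b *\<^sub>R g x)) (at x)"
      using Suc.prems that
      by (intro has_derivative_scaleR frechet_derivative_works[THEN iffD1]) auto
    then show ?thesis by (rule frechet_derivative_apply)
  qed
  have "Ck_on k (\<lambda>x. frechet_derivative (\<lambda>x. f x *\<^sub>R g x) (at x) b) S" if "b \<in> Basis" for b
  proof (subst Ck_on_cong[OF assms(1) D], assumption, intro Ck_on_add assms(1) Suc.IH)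
    show "Ck_on k f S" "Ck_on k g S"
      by (fact Suc.prems[THEN Ck_on_Suc_imp])+
    show "Ck_on k (\<lambda>x. frechet_derivative g (at x) b) S" "Ck_on k (\<lambda>x. frechet_derivative f (at x) b) S"
      using Suc.prems that by auto
  qed
  then show ?case using Suc.prems by simp
qed

lemma Ck_on_linear:
  assumes "open S" "bounded_linear L" "Ck_on k f S"
  shows "Ck_on k (\<lambda>x. L (f x)) S"
  using assms(3)
proof (induction k arbitrary: f)
  case 0
  then show ?case using assms(2) by (simp add: bounded_linear.continuous_on)
next
  case (Suc k)
  have d: "((\<lambda>x. L (f x)) has_derivative (\<lambda>b. L (frechet_derivative f (at x) b))) (at x)"
    if "x \<in> S" for x
    using Suc.prems that
    by (intro bounded_linear.has_derivative[OF assms(2)] frechet_derivative_works[THEN iffD1]) auto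
  have D: "frechet_derivative (\<lambda>x. L (f x)) (at x) b = L (frechet_derivative f (at x) b)"
    if "x \<in> S" for x b
    using d[OF that] by (rule frechet_derivative_apply)
  have "Ck_on k (\<lambda>x. frechet_derivative (\<lambda>x. L (f x)) (at x) b) S" if "b \<in> Basis" for b
    by (subst Ck_on_cong[OF assms(1) D]) (use Suc that in auto)
  then show ?case using d by (auto simp: differentiable_def)
qed

lemma Ck_on_sum:
  assumes "open S" "\<And>i. i \<in> A \<Longrightarrow> Ck_on k (f i) S"
  shows "Ck_on k (\<lambda>x. \<Sum>i\<in>A. f i x) S"
  using assms(2)
  by (induction A rule: infinite_finite_induct) (auto intro!: Ck_on_add Ck_on_const assms(1))

text \<open>The induction keeps \<open>f\<close> fixed and generalises over \<open>g\<close>: by the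
  chain rule a partial derivative of the composite is a sum of products of a component of the
  derivative of \<open>f\<close> with a partial derivative of \<open>g\<close> composed with
  \<open>f\<close>, and the latter is again an instance of the claim.\<close>

lemma Ck_on_compose:
  fixes f :: "'a::euclidean_space \<Rightarrow> 'b::euclidean_space"
  assumes "open S" "open T" "f ` S \<subseteq> T" "Ck_on k f S" "Ck_on k g T"
  shows "Ck_on k (g \<circ> f) S"
  using assms(4,5)
proof (induction k arbitrary: g)
  case 0
  then show ?case
    using assms(3) by (simp only: Ck_on.simps) (blast intro: continuous_on_compose continuous_on_subset)
next
  case (Suc k)
  have d: "(g \<circ> f has_derivative (frechet_derivative g (at (f x)) \<circ> frechet_derivative f (at x))) (at x)"
    if "x \<in> S" for x
    using Suc.prems that assms(3)[THEN subsetD, OF imageI, OF that]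
    by (intro diff_chain_at frechet_derivative_works[THEN iffD1]) auto
  have D: "frechet_derivative (g \<circ> f) (at x) b =
      (\<Sum>c\<in>Basis. (frechet_derivative f (at x) b \<bullet> c) *\<^sub>R
        ((\<lambda>y. frechet_derivative g (at y) c) \<circ> f) x)" if "x \<in> S" for x b
  proof -
    have lin: "linear (frechet_derivative g (at (f x)))"
      using Suc.prems assms(3)[THEN subsetD, OF imageI, OF that]
      by (intro linear_frechet_derivative) auto
    have "frechet_derivative (g \<circ> f) (at x) b =
      frechet_derivative g (at (f x)) (\<Sum>c\<in>Basis. (frechet_derivative f (at x) b \<bullet> c) *\<^sub>R c)"
      by (simp add: frechet_derivative_apply[OF d[OF that]] euclidean_representation)
    also have "\<dots> = (\<Sum>c\<in>Basis. (frechet_derivative f (at x) b \<bullet> c) *\<^sub>R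
        ((\<lambda>y. frechet_derivative g (at y) c) \<circ> f) x)"
      by (simp add: linear_sum[OF lin] linear_cmul[OF lin])
    finally show ?thesis .
  qed
  have "Ck_on k (\<lambda>x. frechet_derivative (g \<circ> f) (at x) b) S" if b: "b \<in> Basis" for b
  proof (subst Ck_on_cong[OF assms(1) D], assumption, intro Ck_on_sum Ck_on_scaleR assms(1))
    fix c :: 'b assume c: "c \<in> Basis"
    show "Ck_on k (\<lambda>x. frechet_derivative f (at x) b \<bullet> c) S"
      using Suc.prems(1) b by (intro Ck_on_linear[OF assms(1) bounded_linear_inner_left]) auto
    show "Ck_on k ((\<lambda>y. frechet_derivative g (at y) c) \<circ> f) S"
      using Suc.prems(2) c Ck_on_Suc_imp[OF Suc.prems(1)] by (intro Suc.IH) auto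
  qed
  then show ?case using d unfolding Ck_on.simps differentiable_def by blast
qed

lemma smooth_on_cong:
  assumes "open S" "\<And>x. x \<in> S \<Longrightarrow> f x = g x"
  shows "smooth_on S f \<longleftrightarrow> smooth_on S g"
  using Ck_on_cong[OF assms] by (simp add: smooth_on_def)

lemma smooth_on_subset: "smooth_on S f \<Longrightarrow> T \<subseteq> S \<Longrightarrow> smooth_on T f"
  by (auto simp: smooth_on_def intro: Ck_on_subset)

lemma smooth_on_const: "smooth_on S (\<lambda>x. c)"
  by (simp add: smooth_on_def Ck_on_const)

lemma smooth_on_add:
  "open S \<Longrightarrow> smooth_on S f \<Longrightarrow> smooth_on S g \<Longrightarrow> smooth_on S (\<lambda>x. f x + g x)"
  by (simp add: smooth_on_def Ck_on_add)

lemma smooth_on_scaleR: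
  "open S \<Longrightarrow> smooth_on S f \<Longrightarrow> smooth_on S g \<Longrightarrow> smooth_on S (\<lambda>x. f x *\<^sub>R g x)"
  by (simp add: smooth_on_def Ck_on_scaleR)

lemma smooth_on_mult:
  fixes f g :: "'a::euclidean_space \<Rightarrow> real"
  shows "open S \<Longrightarrow> smooth_on S f \<Longrightarrow> smooth_on S g \<Longrightarrow> smooth_on S (\<lambda>x. f x * g x)"
  using smooth_on_scaleR[of S f g] by simp

lemma smooth_on_diff:
  fixes f g :: "'a::euclidean_space \<Rightarrow> real"
  shows "open S \<Longrightarrow> smooth_on S f \<Longrightarrow> smooth_on S g \<Longrightarrow> smooth_on S (\<lambda>x. f x - g x)"
  using smooth_on_add[of S f "\<lambda>x. (-1) * g x"] smooth_on_mult[of S "\<lambda>x. -1" g]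
  by (simp add: smooth_on_const)

lemma smooth_on_sum:
  "open S \<Longrightarrow> (\<And>i. i \<in> A \<Longrightarrow> smooth_on S (f i)) \<Longrightarrow> smooth_on S (\<lambda>x. \<Sum>i\<in>A. f i x)"
  by (simp add: smooth_on_def Ck_on_sum)

lemma smooth_on_linear:
  "open S \<Longrightarrow> bounded_linear L \<Longrightarrow> smooth_on S f \<Longrightarrow> smooth_on S (\<lambda>x. L (f x))"
  by (simp add: smooth_on_def Ck_on_linear)

lemma smooth_on_ident: "smooth_on S (\<lambda>x. x)"
proof -
  have "Ck_on k (\<lambda>x. x) S" for k
    by (cases k) (simp_all add: Ck_on_const)
  then show ?thesis by (simp add: smooth_on_def)
qed

lemma smooth_on_compose:
  fixes f :: "'a::euclidean_space \<Rightarrow> 'b::euclidean_space"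
  assumes "open S" "open T" "f ` S \<subseteq> T" "smooth_on S f" "smooth_on T g"
  shows "smooth_on S (g \<circ> f)"
  using Ck_on_compose[OF assms(1-3)] assms(4,5) unfolding smooth_on_def by blast

lemma smooth_on_vec:
  fixes f :: "'a::euclidean_space \<Rightarrow> real^'n"
  assumes "open S" "\<And>i. smooth_on S (\<lambda>x. f x $ i)"
  shows "smooth_on S f"
proof -
  have "f = (\<lambda>x. \<Sum>i\<in>UNIV. (f x $ i) *\<^sub>R axis i 1)"
    by (auto simp: vec_eq_iff axis_def if_distrib cong: if_cong)
  moreover have "smooth_on S (\<lambda>x. \<Sum>i\<in>UNIV. (f x $ i) *\<^sub>R axis i (1::real))"
    by (intro smooth_on_sum smooth_on_scaleR smooth_on_const assms)
  ultimately show ?thesis by simp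
qed

lemma smooth_on_nth:
  fixes f :: "'a::euclidean_space \<Rightarrow> (('b::real_normed_vector)^'n)"
  shows "open S \<Longrightarrow> smooth_on S f \<Longrightarrow> smooth_on S (\<lambda>x. f x $ i)"
  by (rule smooth_on_linear) (auto intro: bounded_linear_vec_nth)

lemma smooth_on_differentiable: "smooth_on S f \<Longrightarrow> x \<in> S \<Longrightarrow> f differentiable (at x)"
  unfolding smooth_on_def using Ck_on.simps(2)[of 0] by blast

lemma smooth_on_continuous: "smooth_on S f \<Longrightarrow> continuous_on S f"
  unfolding smooth_on_def using Ck_on.simps(1) by blast

section \<open>Partial derivatives and their symmetry\<close>

definition pd :: "'n::finite \<Rightarrow> (real^'n \<Rightarrow> 'b::real_normed_vector) \<Rightarrow> real^'n \<Rightarrow> 'b" where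
  "pd j f x = frechet_derivative f (at x) (axis j 1)"

lemma smooth_on_pd:
  assumes "smooth_on S f" shows "smooth_on S (pd j f)"
  unfolding smooth_on_def
proof
  fix k
  have "axis j (1::real) \<in> Basis" by (simp add: axis_in_Basis_iff)
  with assms Ck_on.simps(2)[of k f S] show "Ck_on k (pd j f) S"
    unfolding smooth_on_def pd_def by blast
qed

lemma pd_cong:
  assumes "open S" "x \<in> S" "\<And>y. y \<in> S \<Longrightarrow> f y = g y"
  shows "pd j f x = pd j g x"
  unfolding pd_def using frechet_derivative_cong_open[OF assms] by simp

lemma pd_eqI: "(f has_derivative D) (at x) \<Longrightarrow> pd j f x = D (axis j 1)"
  unfolding pd_def by (rule frechet_derivative_apply)

lemma has_derivative_pd:
  fixes f :: "real^'n \<Rightarrow> 'b::real_normed_vector"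
  assumes "f differentiable (at x)"
  shows "(f has_derivative (\<lambda>w. \<Sum>j\<in>UNIV. (w $ j) *\<^sub>R pd j f x)) (at x)"
proof -
  have lin: "linear (frechet_derivative f (at x))"
    using assms by (rule linear_frechet_derivative)
  have "frechet_derivative f (at x) w = (\<Sum>j\<in>UNIV. (w $ j) *\<^sub>R pd j f x)" for w
  proof -
    have "w = (\<Sum>j\<in>UNIV. (w $ j) *\<^sub>R axis j 1)"
      by (auto simp: vec_eq_iff axis_def if_distrib cong: if_cong)
    then have "frechet_derivative f (at x) w =
        frechet_derivative f (at x) (\<Sum>j\<in>UNIV. (w $ j) *\<^sub>R axis j 1)"
      by simp
    then show ?thesis
      by (simp add: pd_def linear_sum[OF lin] linear_cmul[OF lin])
  qed
  then have "frechet_derivative f (at x) = (\<lambda>w. \<Sum>j\<in>UNIV. (w $ j) *\<^sub>R pd j f x)" by blast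
  with frechet_derivative_works[THEN iffD1, OF assms] show ?thesis by simp
qed

lemma pd_nth:
  fixes f :: "real^'n \<Rightarrow> 'b::real_normed_vector^'m"
  assumes "f differentiable (at x)"
  shows "pd j (\<lambda>x. f x $ i) x = pd j f x $ i"
proof -
  have "((\<lambda>x. f x $ i) has_derivative (\<lambda>w. frechet_derivative f (at x) w $ i)) (at x)"
    by (intro bounded_linear.has_derivative[OF bounded_linear_vec_nth]
        frechet_derivative_works[THEN iffD1, OF assms])
  from pd_eqI[OF this] show ?thesis by (simp add: pd_def)
qed

lemma has_real_derivative_line:
  fixes f :: "real^'n \<Rightarrow> real"
  assumes "f differentiable (at (x + t *\<^sub>R axis j 1))"
  shows "((\<lambda>t. f (x + t *\<^sub>R axis j 1)) has_real_derivative pd j f (x + t *\<^sub>R axis j 1)) (at t)"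
proof -
  have "((\<lambda>t. x + t *\<^sub>R axis j 1) has_derivative (\<lambda>h. h *\<^sub>R axis j 1)) (at t)"
    by (auto intro!: derivative_eq_intros)
  from diff_chain_at[OF this frechet_derivative_works[THEN iffD1, OF assms]]
  have "((\<lambda>t. f (x + t *\<^sub>R axis j 1)) has_derivative
      (\<lambda>h. frechet_derivative f (at (x + t *\<^sub>R axis j 1)) (h *\<^sub>R axis j 1))) (at t)"
    by (simp add: o_def)
  moreover have "frechet_derivative f (at (x + t *\<^sub>R axis j 1)) (h *\<^sub>R axis j 1) =
      h * pd j f (x + t *\<^sub>R axis j 1)" for h
    using linear_cmul[OF linear_frechet_derivative[OF assms]] by (simp add: pd_def)
  ultimately show ?thesis
    by (simp add: has_field_derivative_def mult.commute[of _ "pd j f _"])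
qed

text \<open>The second difference quotient over the square spanned by \<open>i\<close> and \<open>j\<close> is, by two
  applications of the mean value theorem, a value of \<open>pd j (pd i f)\<close> on that square.\<close>

lemma second_difference:
  fixes f :: "real^'n \<Rightarrow> real"
  assumes S: "open S" "smooth_on S f" and h: "h > 0"
    and sub: "\<And>s t. 0 \<le> s \<Longrightarrow> s \<le> h \<Longrightarrow> 0 \<le> t \<Longrightarrow> t \<le> h \<Longrightarrow> x + s *\<^sub>R axis i 1 + t *\<^sub>R axis j 1 \<in> S"
  shows "\<exists>s t. 0 \<le> s \<and> s \<le> h \<and> 0 \<le> t \<and> t \<le> h \<and>
     f (x + h *\<^sub>R axis i 1 + h *\<^sub>R axis j 1) - f (x + h *\<^sub>R axis i 1) - f (x + h *\<^sub>R axis j 1) + f x =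
       h\<^sup>2 * pd j (pd i f) (x + s *\<^sub>R axis i 1 + t *\<^sub>R axis j 1)"
proof -
  define g where "g = (\<lambda>s. f (x + h *\<^sub>R axis j 1 + s *\<^sub>R axis i 1) - f (x + s *\<^sub>R axis i 1))"
  have df: "f differentiable (at y)" and dpd: "pd i f differentiable (at y)" if "y \<in> S" for y
    using smooth_on_differentiable[OF S(2) that] smooth_on_differentiable[OF smooth_on_pd[OF S(2)] that]
    by auto
  have in1: "x + h *\<^sub>R axis j 1 + s *\<^sub>R axis i 1 \<in> S" "x + s *\<^sub>R axis i 1 \<in> S"
    if "0 \<le> s" "s \<le> h" for s
    using sub[of s h] sub[of s 0] that h by (auto simp: add_ac)
  have "\<exists>s>0. s < h \<and> g h - g 0 = (h - 0) *
      (pd i f (x + h *\<^sub>R axis j 1 + s *\<^sub>R axis i 1) - pd i f (x + s *\<^sub>R axis i 1))"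
    unfolding g_def
    by (rule MVT2[OF h])
       (use in1 df in \<open>auto intro!: DERIV_diff has_real_derivative_line\<close>)
  then obtain s where s: "0 < s" "s < h" "g h - g 0 = h *
      (pd i f (x + h *\<^sub>R axis j 1 + s *\<^sub>R axis i 1) - pd i f (x + s *\<^sub>R axis i 1))"
    by auto
  have "\<exists>t>0. t < h \<and> pd i f ((x + s *\<^sub>R axis i 1) + h *\<^sub>R axis j 1) -
      pd i f ((x + s *\<^sub>R axis i 1) + 0 *\<^sub>R axis j 1) =
      (h - 0) * pd j (pd i f) ((x + s *\<^sub>R axis i 1) + t *\<^sub>R axis j 1)"
    by (rule MVT2[OF h])
       (use sub s dpd in \<open>auto intro!: has_real_derivative_line\<close>)
  then obtain t where t: "0 < t" "t < h" "pd i f ((x + s *\<^sub>R axis i 1) + h *\<^sub>R axis j 1) -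
      pd i f (x + s *\<^sub>R axis i 1) = h * pd j (pd i f) ((x + s *\<^sub>R axis i 1) + t *\<^sub>R axis j 1)"
    by auto
  have "f (x + h *\<^sub>R axis i 1 + h *\<^sub>R axis j 1) - f (x + h *\<^sub>R axis i 1) - f (x + h *\<^sub>R axis j 1) + f x
      = g h - g 0"
    by (simp add: g_def add_ac)
  also have "\<dots> = h\<^sup>2 * pd j (pd i f) (x + s *\<^sub>R axis i 1 + t *\<^sub>R axis j 1)"
    using s(3) t(3) by (simp add: add_ac power2_eq_square)
  finally show ?thesis using s t by (intro exI[of _ s] exI[of _ t]) auto
qed

text \<open>The second difference over a square is symmetric in \<open>i\<close> and
  \<open>j\<close>, so the two iterated derivatives take a common value at points of every small
  square at \<open>x\<close>; continuity does the rest.\<close>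

lemma pd_commute_real:
  fixes f :: "real^'n \<Rightarrow> real"
  assumes S: "open S" "smooth_on S f" and x: "x \<in> S"
  shows "pd j (pd i f) x = pd i (pd j f) x"
proof (rule ccontr)
  assume ne: "pd j (pd i f) x \<noteq> pd i (pd j f) x"
  \<comment> \<open>Half the gap: two errors below \<open>e\<close> cannot bridge it.\<close>
  define e where "e = \<bar>pd j (pd i f) x - pd i (pd j f) x\<bar> / 2"
  have e: "e > 0" using ne by (simp add: e_def)
  have "\<exists>d>0. \<forall>y. dist y x < d \<longrightarrow> y \<in> S \<and> dist (pd a (pd b f) y) (pd a (pd b f) x) < e" for a b
  proof -
    have "isCont (pd a (pd b f)) x"
      using continuous_on_eq_continuous_at[OF S(1)] x
        smooth_on_continuous[OF smooth_on_pd[OF smooth_on_pd[OF S(2)]]] by blast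
    then obtain d1 where "d1 > 0" "\<forall>y. dist y x < d1 \<longrightarrow> dist (pd a (pd b f) y) (pd a (pd b f) x) < e"
      using e unfolding continuous_at_eps_delta by blast
    moreover obtain d2 where "d2 > 0" "\<forall>y. dist y x < d2 \<longrightarrow> y \<in> S"
      using S(1) x unfolding open_dist by blast
    ultimately show ?thesis by (intro exI[of _ "min d1 d2"]) auto
  qed
  note cont = this
  obtain d1 where d1: "d1 > 0"
    "\<And>y. dist y x < d1 \<Longrightarrow> y \<in> S \<and> dist (pd j (pd i f) y) (pd j (pd i f) x) < e"
    using cont[of j i] by blast
  obtain d2 where d2: "d2 > 0"
    "\<And>y. dist y x < d2 \<Longrightarrow> y \<in> S \<and> dist (pd i (pd j f) y) (pd i (pd j f) x) < e"
    using cont[of i j] by blast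
  note d = d1(1) d2(1) and d1 = d1(2) and d2 = d2(2)
  \<comment> \<open>With a third of the radius, every point of the square lies within
    \<open>2 * h\<close> of \<open>x\<close>, hence inside both balls.\<close>
  define h where "h = min d1 d2 / 3"
  have h: "h > 0" using d by (simp add: h_def)
  have near: "dist (x + s *\<^sub>R axis a 1 + t *\<^sub>R axis b 1) x < d1"
       "dist (x + s *\<^sub>R axis a 1 + t *\<^sub>R axis b 1) x < d2"
    if "0 \<le> s" "s \<le> h" "0 \<le> t" "t \<le> h" for s t and a b :: 'n
  proof -
    have "dist (x + s *\<^sub>R axis a 1 + t *\<^sub>R axis b 1) x = norm (s *\<^sub>R axis a 1 + t *\<^sub>R axis b (1::real))"
      by (simp add: dist_norm)
    also have "\<dots> \<le> norm (s *\<^sub>R axis a (1::real)) + norm (t *\<^sub>R axis b (1::real))"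
      by (rule norm_triangle_ineq)
    also have "\<dots> \<le> h + h" using that by simp
    finally show "dist (x + s *\<^sub>R axis a 1 + t *\<^sub>R axis b 1) x < d1"
       "dist (x + s *\<^sub>R axis a 1 + t *\<^sub>R axis b 1) x < d2"
      using d by (auto simp: h_def)
  qed
  let ?D = "f (x + h *\<^sub>R axis i 1 + h *\<^sub>R axis j 1) - f (x + h *\<^sub>R axis i 1) - f (x + h *\<^sub>R axis j 1) + f x"
  obtain s t where st: "0 \<le> s" "s \<le> h" "0 \<le> t" "t \<le> h"
    "?D = h\<^sup>2 * pd j (pd i f) (x + s *\<^sub>R axis i 1 + t *\<^sub>R axis j 1)"
    using second_difference[OF S h conjunct1[OF d1[OF near(1)]], of i j] by blast
  obtain s' t' where st': "0 \<le> s'" "s' \<le> h" "0 \<le> t'" "t' \<le> h"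
    "f (x + h *\<^sub>R axis j 1 + h *\<^sub>R axis i 1) - f (x + h *\<^sub>R axis j 1) - f (x + h *\<^sub>R axis i 1) + f x
      = h\<^sup>2 * pd i (pd j f) (x + s' *\<^sub>R axis j 1 + t' *\<^sub>R axis i 1)"
    using second_difference[OF S h conjunct1[OF d1[OF near(1)]], of j i] by blast
  have "x + h *\<^sub>R axis j 1 + h *\<^sub>R axis i 1 = x + h *\<^sub>R axis i 1 + h *\<^sub>R axis j 1"
    by (simp add: add_ac)
  then have "f (x + h *\<^sub>R axis j 1 + h *\<^sub>R axis i 1) = f (x + h *\<^sub>R axis i 1 + h *\<^sub>R axis j 1)"
    by (simp only:)
  then have "h\<^sup>2 * pd j (pd i f) (x + s *\<^sub>R axis i 1 + t *\<^sub>R axis j 1) =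
      h\<^sup>2 * pd i (pd j f) (x + s' *\<^sub>R axis j 1 + t' *\<^sub>R axis i 1)"
    using st(5) st'(5) by linarith
  then have "pd j (pd i f) (x + s *\<^sub>R axis i 1 + t *\<^sub>R axis j 1) =
      pd i (pd j f) (x + s' *\<^sub>R axis j 1 + t' *\<^sub>R axis i 1)"
    using h by simp
  with conjunct2[OF d1[OF near(1)[OF st(1-4)]]] conjunct2[OF d2[OF near(2)[OF st'(1-4)]]]
  have "dist (pd j (pd i f) x) (pd i (pd j f) x) < e + e"
    by (smt (verit) dist_triangle3 dist_commute)
  then show False by (simp add: e_def dist_real_def)
qed

lemma pd_commute:
  fixes f :: "real^'n \<Rightarrow> real^'m"
  assumes S: "open S" "smooth_on S f" and x: "x \<in> S"
  shows "pd j (pd i f) x = pd i (pd j f) x"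
proof -
  have "pd b (pd a f) x $ k = pd b (pd a (\<lambda>y. f y $ k)) x" for a b k
  proof -
    have "pd b (pd a f) x $ k = pd b (\<lambda>y. pd a f y $ k) x"
      using S x by (intro pd_nth[symmetric]) (auto intro: smooth_on_differentiable smooth_on_pd)
    also have "\<dots> = pd b (pd a (\<lambda>y. f y $ k)) x"
      using S x by (intro pd_cong[of S]) (auto simp: pd_nth smooth_on_differentiable)
    finally show ?thesis .
  qed
  then show ?thesis
    using pd_commute_real[OF S(1) smooth_on_nth[OF S] x] by (simp add: vec_eq_iff)
qed

section \<open>Limits along the Penrose scaling\<close>

lemma pullback_pd:
  "pullback \<tau> G q $ i $ j = (\<Sum>k\<in>UNIV. \<Sum>l\<in>UNIV. pd i \<tau> q $ k * G (\<tau> q) $ k $ l * pd j \<tau> q $ l)"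
proof -
  have "pullback \<tau> G q $ i $ j =
      (\<Sum>l\<in>UNIV. \<Sum>k\<in>UNIV. pd i \<tau> q $ k * G (\<tau> q) $ k $ l * pd j \<tau> q $ l)"
    by (simp add: pullback_def Let_def matrix_def matrix_matrix_mult_def transpose_def pd_def
        sum_distrib_right)
  then show ?thesis by (subst sum.swap)
qed

lemma sum_UNIV_split:
  fixes g :: "'n::finite \<Rightarrow> 'c::comm_monoid_add"
  assumes "u \<noteq> v"
  shows "(\<Sum>i\<in>UNIV. g i) = g u + (g v + (\<Sum>i\<in>-{u,v}. g i))"
proof -
  have "(UNIV::'n set) = insert u (insert v (-{u,v}))" by auto
  then have "(\<Sum>i\<in>UNIV. g i) = sum g (insert u (insert v (-{u,v})))" by simp
  also have "\<dots> = g u + (g v + (\<Sum>i\<in>-{u,v}. g i))" using assms by simp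
  finally show ?thesis .
qed

text \<open>The diagonal of the Jacobian of \<open>penrose_scaling\<close>.\<close>

definition scaling_weight :: "'n \<Rightarrow> 'n \<Rightarrow> real \<Rightarrow> 'n \<Rightarrow> real" where
  "scaling_weight u v \<Omega> i = (if i = u then 1 else if i = v then \<Omega>\<^sup>2 else \<Omega>)"

text \<open>The limit metric in closed form, a plane wave in Rosen coordinates; it depends on the
  point only through its u-coordinate \<open>s\<close>.\<close>

definition plane_wave :: "'n::finite \<Rightarrow> 'n \<Rightarrow> (real^'n \<Rightarrow> real^'n^'n) \<Rightarrow> real \<Rightarrow> real^'n^'n" where
  "plane_wave u v G s =
     (\<chi> i j. if {i, j} = {u, v} then 1 / 2
             else if i \<in> {u, v} \<or> j \<in> {u, v} then 0 else G (axis u s) $ i $ j)"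

lemma tendsto_penrose_scaling:
  "(\<lambda>\<Omega>. penrose_scaling u v \<Omega> q) \<midarrow>0\<rightarrow> axis u (q $ u)"
proof (rule vec_tendstoI)
  fix i
  show "(\<lambda>\<Omega>. penrose_scaling u v \<Omega> q $ i) \<midarrow>0\<rightarrow> axis u (q $ u) $ i"
    by (cases "i = u"; cases "i = v")
       (auto simp: penrose_scaling_def axis_def intro!: tendsto_eq_intros)
qed

lemma penrose_scaling_0: "u \<noteq> v \<Longrightarrow> penrose_scaling u v 0 q = axis u (q $ u)"
  by (auto simp: penrose_scaling_def axis_def vec_eq_iff)

text \<open>For fixed \<open>q\<close> the scaled points form a curve in \<Omega> that leaves the
  geodesic at \<Omega> = 0 with the y-part of \<open>q\<close> as velocity; the v-part enters only
  at second order. All expansions below are taken along this curve.\<close>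

lemma has_derivative_penrose_scaling:
  assumes "u \<noteq> v"
  shows "((\<lambda>\<Omega>. penrose_scaling u v \<Omega> q) has_derivative
    (\<lambda>h. h *\<^sub>R (\<chi> i. if i = u then 0 else if i = v then 2 * \<Omega> * q $ v else q $ i))) (at \<Omega>)"
proof -
  define y where "y = (\<chi> i. if i = u \<or> i = v then 0 else q $ i)"
  have "(\<lambda>\<Omega>. penrose_scaling u v \<Omega> q) =
      (\<lambda>\<Omega>. axis u (q $ u) + \<Omega>\<^sup>2 *\<^sub>R axis v (q $ v) + \<Omega> *\<^sub>R y)"
    using assms by (auto simp: fun_eq_iff vec_eq_iff penrose_scaling_def axis_def y_def)
  moreover have "(\<lambda>h. h *\<^sub>R (\<chi> i. if i = u then 0 else if i = v then 2 * \<Omega> * q $ v else q $ i)) =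
      (\<lambda>h. (2 * \<Omega> * h) *\<^sub>R axis v (q $ v) + h *\<^sub>R y)"
    using assms by (auto simp: fun_eq_iff vec_eq_iff axis_def y_def)
  ultimately show ?thesis
    by (auto intro!: derivative_eq_intros)
qed

lemma DERIV_along_scaling:
  fixes k :: "real^'n \<Rightarrow> real"
  assumes "u \<noteq> v" "k differentiable (at (penrose_scaling u v \<Omega> q))"
  shows "((\<lambda>\<Omega>. k (penrose_scaling u v \<Omega> q)) has_real_derivative
    2 * \<Omega> * q $ v * pd v k (penrose_scaling u v \<Omega> q) +
     (\<Sum>j\<in>-{u,v}. q $ j * pd j k (penrose_scaling u v \<Omega> q))) (at \<Omega>)"
proof -
  have "(\<Sum>j\<in>UNIV. (h *\<^sub>R (\<chi> i. if i = u then 0 else if i = v then 2 * \<Omega> * q $ v else q $ i)) $ j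
        *\<^sub>R pd j k (penrose_scaling u v \<Omega> q)) =
     (2 * \<Omega> * q $ v * pd v k (penrose_scaling u v \<Omega> q) +
     (\<Sum>j\<in>-{u,v}. q $ j * pd j k (penrose_scaling u v \<Omega> q))) * h" for h
    using assms(1)
    by (subst sum_UNIV_split[OF assms(1)])
       (auto simp: algebra_simps sum_distrib_left intro!: sum.cong)
  with diff_chain_at[OF has_derivative_penrose_scaling[OF assms(1)] has_derivative_pd[OF assms(2)]]
  show ?thesis
    by (simp add: has_field_derivative_def o_def mult_commute_abs cong: sum.cong)
qed

text \<open>As \<open>k\<close> vanishes at the base point, the quotient is a difference quotient at
  0 along the scaling curve. The v-derivative carries a factor \<Omega> and drops out.\<close>

lemma tendsto_first_order:
  fixes k :: "real^'n \<Rightarrow> real"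
  assumes uv: "u \<noteq> v" and d: "k differentiable (at (axis u (q $ u)))" and 0: "k (axis u (q $ u)) = 0"
  shows "((\<lambda>\<Omega>. k (penrose_scaling u v \<Omega> q) / \<Omega>) \<longlongrightarrow>
    (\<Sum>j\<in>-{u,v}. q $ j * pd j k (axis u (q $ u)))) (at_right 0)"
proof -
  have "((\<lambda>\<Omega>. k (penrose_scaling u v \<Omega> q)) has_real_derivative
     (\<Sum>j\<in>-{u,v}. q $ j * pd j k (axis u (q $ u)))) (at 0)"
    using DERIV_along_scaling[OF uv, of k 0 q] d by (simp add: penrose_scaling_0[OF uv])
  then have "(\<lambda>h. k (penrose_scaling u v h q) / h) \<midarrow>0\<rightarrow> (\<Sum>j\<in>-{u,v}. q $ j * pd j k (axis u (q $ u)))"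
    using 0 by (simp add: DERIV_def penrose_scaling_0[OF uv])
  then show ?thesis by (rule filterlim_mono) (auto simp: at_le)
qed

text \<open>L'Hopital's rule takes the place of a Taylor remainder. In the derivative along the
  curve divided by \<open>2 * \<Omega>\<close>, the factor \<Omega> of the v-term cancels, and each
  y-term is a first-order quotient of \<open>pd m k\<close>, which vanishes at the base point by
  assumption.\<close>

lemma tendsto_second_order:
  fixes k :: "real^'n \<Rightarrow> real"
  assumes uv: "u \<noteq> v" and S: "open S" "smooth_on S k" and p: "axis u (q $ u) \<in> S"
    and 0: "k (axis u (q $ u)) = 0" and 1: "\<And>j. j \<notin> {u,v} \<Longrightarrow> pd j k (axis u (q $ u)) = 0"
  shows "((\<lambda>\<Omega>. k (penrose_scaling u v \<Omega> q) / \<Omega>\<^sup>2) \<longlongrightarrow>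
    q $ v * pd v k (axis u (q $ u)) +
    (\<Sum>j\<in>-{u,v}. \<Sum>m\<in>-{u,v}. q $ j * q $ m * pd j (pd m k) (axis u (q $ u))) / 2) (at_right 0)"
    (is "(_ \<longlongrightarrow> ?R) _")
proof -
  let ?c = "\<lambda>\<Omega>. penrose_scaling u v \<Omega> q" and ?p = "axis u (q $ u)"
  let ?D = "\<lambda>\<Omega>. 2 * \<Omega> * q $ v * pd v k (?c \<Omega>) + (\<Sum>j\<in>-{u,v}. q $ j * pd j k (?c \<Omega>))"
  have c: "(?c \<longlongrightarrow> ?p) (at_right 0)"
    using tendsto_penrose_scaling by (rule filterlim_mono) (auto simp: at_le)
  have pos: "\<forall>\<^sub>F \<Omega> in at_right 0. \<Omega> > (0::real)" by (rule eventually_at_right_less)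
  have ev: "\<forall>\<^sub>F \<Omega> in at_right 0. ?c \<Omega> \<in> S"
    using topological_tendstoD[OF c S(1) p] .
  have cont: "((\<lambda>\<Omega>. g (?c \<Omega>)) \<longlongrightarrow> g ?p) (at_right 0)" if "smooth_on S g" for g :: "real^'n \<Rightarrow> real"
    using smooth_on_continuous[OF that] S(1) p c
    by (metis continuous_on_eq_continuous_at isCont_tendsto_compose)
  have lim: "((\<lambda>\<Omega>. ?D \<Omega> / (2 * \<Omega>)) \<longlongrightarrow> ?R) (at_right 0)"
  proof -
    have "((\<lambda>\<Omega>. q $ v * pd v k (?c \<Omega>) + (\<Sum>m\<in>-{u,v}. q $ m * (pd m k (?c \<Omega>) / \<Omega>)) / 2) \<longlongrightarrow>
       q $ v * pd v k ?p + (\<Sum>m\<in>-{u,v}. q $ m * (\<Sum>j\<in>-{u,v}. q $ j * pd j (pd m k) ?p)) / 2) (at_right 0)"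
      using 1 p S(2)
      by (intro tendsto_add tendsto_mult tendsto_divide tendsto_const tendsto_sum cont
          tendsto_first_order[OF uv] smooth_on_pd)
         (auto intro: smooth_on_differentiable[OF smooth_on_pd])
    moreover have "(\<Sum>m\<in>-{u,v}. q $ m * (\<Sum>j\<in>-{u,v}. q $ j * pd j (pd m k) ?p)) =
       (\<Sum>j\<in>-{u,v}. \<Sum>m\<in>-{u,v}. q $ j * q $ m * pd j (pd m k) ?p)"
      by (subst sum.swap) (auto simp: sum_distrib_left algebra_simps intro!: sum.cong)
    moreover have "\<forall>\<^sub>F \<Omega> in at_right 0. ?D \<Omega> / (2 * \<Omega>) =
        q $ v * pd v k (?c \<Omega>) + (\<Sum>m\<in>-{u,v}. q $ m * (pd m k (?c \<Omega>) / \<Omega>)) / 2"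
      using pos
    proof eventually_elim
      case (elim \<Omega>)
      have "(\<Sum>m\<in>-{u,v}. q $ m * (pd m k (?c \<Omega>) / \<Omega>)) = (\<Sum>j\<in>-{u,v}. q $ j * pd j k (?c \<Omega>)) / \<Omega>"
        by (simp add: sum_divide_distrib)
      then show ?case using elim by (simp add: field_simps)
    qed
    ultimately show ?thesis by (simp only: tendsto_cong)
  qed
  show ?thesis
  proof (rule lhopital_right_0[where f' = ?D and g' = "\<lambda>\<Omega>. 2 * \<Omega>"])
    show "((\<lambda>\<Omega>. k (?c \<Omega>)) \<longlongrightarrow> 0) (at_right 0)" using cont[OF S(2)] 0 by simp
    show "((\<lambda>\<Omega>::real. \<Omega>\<^sup>2) \<longlongrightarrow> 0) (at_right 0)" by (auto intro!: tendsto_eq_intros)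
    show "\<forall>\<^sub>F \<Omega>::real in at_right 0. \<Omega>\<^sup>2 \<noteq> 0" "\<forall>\<^sub>F \<Omega>::real in at_right 0. 2 * \<Omega> \<noteq> 0"
      using pos by (auto elim: eventually_mono)
    show "\<forall>\<^sub>F \<Omega> in at_right 0. ((\<lambda>\<Omega>. k (?c \<Omega>)) has_real_derivative ?D \<Omega>) (at \<Omega>)"
      using ev by eventually_elim (intro DERIV_along_scaling[OF uv] smooth_on_differentiable[OF S(2)])
    show "\<forall>\<^sub>F \<Omega>::real in at_right 0. ((\<lambda>\<Omega>. \<Omega>\<^sup>2) has_real_derivative 2 * \<Omega>) (at \<Omega>)"
      by (auto intro!: derivative_eq_intros always_eventually)
    show "((\<lambda>\<Omega>. ?D \<Omega> / (2 * \<Omega>)) \<longlongrightarrow> ?R) (at_right 0)" by (rule lim)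
  qed
qed

text \<open>The entries with a negative power of \<Omega>, namely (u,u) and (u,y), are zero on all
  of \<open>U\<close> by the adapted form, and (u,v) is the constant 1/2; the others carry a
  nonnegative power. The curve \<open>r\<close> is arbitrary because the lemma is applied both to
  the scaled points and to their images under the isometry.\<close>

lemma tendsto_scaled_metric:
  fixes G :: "real^'n \<Rightarrow> real^'n^'n"
  assumes ad: "adapted_form u v U G" and uv: "u \<noteq> v" and U: "open U" and cont: "continuous_on U G"
    and sym: "\<And>p. p \<in> U \<Longrightarrow> transpose (G p) = G p" and s: "axis u s \<in> U"
    and r: "(r \<longlongrightarrow> axis u s) (at_right 0)"
  shows "((\<lambda>\<Omega>. scaling_weight u v \<Omega> i * scaling_weight u v \<Omega> j / \<Omega>\<^sup>2 * G (r \<Omega>) $ i $ j) \<longlongrightarrow>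
     plane_wave u v G s $ i $ j) (at_right 0)"
proof -
  \<comment> \<open>The power of \<Omega> left for entries without an index
    \<open>u\<close>.\<close>
  define c :: "real \<Rightarrow> real"
    where "c = (\<lambda>\<Omega>. if i = v \<and> j = v then \<Omega>\<^sup>2 else if i = v \<or> j = v then \<Omega> else 1)"
  define H where "H = (\<lambda>\<Omega>. if {i, j} = {u, v} then 1 / 2 else if i = u \<or> j = u then 0
        else c \<Omega> * G (r \<Omega>) $ i $ j)"
  have "\<forall>\<^sub>F \<Omega> in at_right 0. r \<Omega> \<in> U \<and> \<Omega> > 0"
    using topological_tendstoD[OF r U s] eventually_at_right_less[of "0::real"]
    by eventually_elim auto
  then have "\<forall>\<^sub>F \<Omega> in at_right 0. H \<Omega> =
      scaling_weight u v \<Omega> i * scaling_weight u v \<Omega> j / \<Omega>\<^sup>2 * G (r \<Omega>) $ i $ j"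
  proof eventually_elim
    case (elim \<Omega>)
    note K = adapted_form_components[OF ad uv conjunct1[OF elim] sym[OF conjunct1[OF elim]]]
    show ?case
      using elim uv K(1-3) K(4)[of j] K(5)[of i]
      by (auto simp: H_def c_def scaling_weight_def power2_eq_square field_simps
          doubleton_eq_iff split: if_splits)
  qed
  moreover have "(H \<longlongrightarrow> plane_wave u v G s $ i $ j) (at_right 0)"
  proof -
    have "((\<lambda>\<Omega>. G (r \<Omega>)) \<longlongrightarrow> G (axis u s)) (at_right 0)"
      using cont U s r by (metis continuous_on_eq_continuous_at isCont_tendsto_compose)
    then have Gij: "((\<lambda>\<Omega>. G (r \<Omega>) $ i $ j) \<longlongrightarrow> G (axis u s) $ i $ j) (at_right 0)"
      by (intro tendsto_vec_nth)
    have "(c \<longlongrightarrow> (if i = v \<or> j = v then 0 else 1)) (at_right 0)"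
      unfolding c_def
      by (cases "i = v"; cases "j = v") (auto intro!: tendsto_eq_intros)
    from tendsto_mult[OF this Gij] show ?thesis
      unfolding H_def plane_wave_def using uv
      by (cases "{i, j} = {u, v}"; cases "i = u \<or> j = u"; cases "i = v \<or> j = v") force+
  qed
  ultimately show ?thesis by (simp only: tendsto_cong)
qed

section \<open>The limiting isometry\<close>

lemma penrose_metric_eq_plane_wave:
  fixes G :: "real^'n \<Rightarrow> real^'n^'n"
  assumes "adapted_form u v U G" "u \<noteq> v" "open U" "continuous_on U G"
    "\<And>p. p \<in> U \<Longrightarrow> transpose (G p) = G p" "axis u (q $ u) \<in> U"
  shows "penrose_metric u v G q = plane_wave u v G (q $ u)"
  using penrose_metric_adapted[OF assms] by (simp add: plane_wave_def)

section \<open>The Jacobian of the isometry along the curve\<close>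

lemma pd_along_axis_eq_0:
  fixes k :: "real^'n \<Rightarrow> real"
  assumes S: "open S" and p: "axis u s \<in> S" and d: "k differentiable (at (axis u s))"
    and 0: "\<And>t. axis u t \<in> S \<Longrightarrow> k (axis u t) = 0"
  shows "pd u k (axis u s) = 0"
proof -
  have ax: "axis u s + t *\<^sub>R axis u 1 = (axis u (s + t) :: real^'n)" for t
    by (simp add: vec_eq_iff axis_def)
  have "((\<lambda>t. k (axis u s + t *\<^sub>R axis u 1)) has_real_derivative
      pd u k (axis u s + 0 *\<^sub>R axis u 1)) (at 0)"
    by (rule has_real_derivative_line) (use d in simp)
  \<comment> \<open>Only parameters near 0 are controlled, since \<open>S\<close> need not contain
    the whole axis.\<close>
  moreover have "\<forall>\<^sub>F t in nhds 0. k (axis u s + t *\<^sub>R axis u 1) = 0"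
  proof -
    have "isCont (\<lambda>t. axis u s + t *\<^sub>R axis u 1 :: real^'n) 0" by (intro continuous_intros)
    then have "((\<lambda>t. axis u s + t *\<^sub>R axis u 1 :: real^'n) \<longlongrightarrow> axis u s) (nhds 0)"
      unfolding continuous_at tendsto_nhds_iff by simp
    from topological_tendstoD[OF this S p] show ?thesis
      by eventually_elim (use 0 in \<open>auto simp: ax\<close>)
  qed
  ultimately have "((\<lambda>t. 0) has_real_derivative pd u k (axis u s + 0 *\<^sub>R axis u 1)) (at (0::real))"
    using DERIV_cong_ev[OF refl _ refl, of "\<lambda>t. k (axis u s + t *\<^sub>R axis u 1)" "\<lambda>t. 0" 0] by blast
  then have "pd u k (axis u s + 0 *\<^sub>R axis u 1) = 0"
    using DERIV_const[of 0] DERIV_unique by blast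
  then show ?thesis by simp
qed

text \<open>The situation in coordinates. The metrics are adapted on the chart images
  \<open>U\<close> and \<open>U'\<close>, while the isometry exists only between the smaller sets
  \<open>D\<close> and \<open>D'\<close>. These contain the axis segments of the chart images, and
  since they are open, the scaled points enter \<open>D\<close> as \<Omega> tends to 0.\<close>

locale adapted_isometry =
  fixes u v :: "'n::finite" and U U' D D' :: "(real^'n) set"
    and G G' :: "real^'n \<Rightarrow> real^'n^'n" and F F' :: "real^'n \<Rightarrow> real^'n"
  assumes uv: "u \<noteq> v" and open_U: "open U" and open_U': "open U'"
    and open_D: "open D" and open_D': "open D'"
    and D_subset: "D \<subseteq> U" and D'_subset: "D' \<subseteq> U'"
    and F_in: "\<And>q. q \<in> D \<Longrightarrow> F q \<in> D'" and F'_in: "\<And>q. q \<in> D' \<Longrightarrow> F' q \<in> D"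
    and F'_F: "\<And>q. q \<in> D \<Longrightarrow> F' (F q) = q" and F_F': "\<And>q. q \<in> D' \<Longrightarrow> F (F' q) = q"
    and smooth_F: "smooth_on D F" and smooth_F': "smooth_on D' F'"
    and cont_G: "continuous_on U G" and cont_G': "continuous_on U' G'"
    and sym_G: "\<And>q. q \<in> U \<Longrightarrow> transpose (G q) = G q"
    and sym_G': "\<And>q. q \<in> U' \<Longrightarrow> transpose (G' q) = G' q"
    and adapted_G: "adapted_form u v U G" and adapted_G': "adapted_form u v U' G'"
    and metric: "\<And>q. q \<in> D \<Longrightarrow> G q = pullback F G' q"
    and axis_in: "\<And>s. axis u s \<in> U \<Longrightarrow> axis u s \<in> D \<and> F (axis u s) \<in> range (axis u)"
    and axis_in': "\<And>s. axis u s \<in> U' \<Longrightarrow> axis u s \<in> D' \<and> F' (axis u s) \<in> range (axis u)"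
begin

lemma F_axis: "axis u s \<in> U \<Longrightarrow> F (axis u s) = axis u (F (axis u s) $ u)"
  using axis_in[of s] by auto

lemma F'_axis: "axis u s \<in> U' \<Longrightarrow> F' (axis u s) = axis u (F' (axis u s) $ u)"
  using axis_in'[of s] by auto

lemma F_axis_in: "axis u s \<in> U \<Longrightarrow> axis u (F (axis u s) $ u) \<in> U'"
  using axis_in[of s] F_axis[of s] F_in D'_subset by force

lemma F'_axis_in: "axis u s \<in> U' \<Longrightarrow> axis u (F' (axis u s) $ u) \<in> U"
  using axis_in'[of s] F'_axis[of s] F'_in D_subset by force

lemma dF: "q \<in> D \<Longrightarrow> F differentiable (at q)"
  using smooth_F by (rule smooth_on_differentiable)

lemma dF': "q \<in> D' \<Longrightarrow> F' differentiable (at q)"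
  using smooth_F' by (rule smooth_on_differentiable)

lemma smooth_F_nth: "smooth_on D (\<lambda>q. F q $ i)"
  "smooth_on D (\<lambda>q. pd j F q $ i)" "smooth_on D (\<lambda>q. pd k (pd j F) q $ i)"
  by (intro smooth_on_nth[OF open_D] smooth_on_pd smooth_F)+

lemma pd_F_nth: "q \<in> D \<Longrightarrow> pd j (\<lambda>q. F q $ i) q = pd j F q $ i"
  by (intro pd_nth dF)

lemma pd_pd_F_nth: "q \<in> D \<Longrightarrow> pd k (\<lambda>q. pd j F q $ i) q = pd k (pd j F) q $ i"
  by (intro pd_nth smooth_on_differentiable[OF smooth_on_pd[OF smooth_F]])

lemma pd_u_F:
  assumes "axis u s \<in> U" "i \<noteq> u"
  shows "pd u F (axis u s) $ i = 0"
proof -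
  have "pd u (\<lambda>q. F q $ i) (axis u s) = 0"
  proof (rule pd_along_axis_eq_0[OF open_D])
    show "axis u s \<in> D" using axis_in assms by blast
    then show "(\<lambda>q. F q $ i) differentiable (at (axis u s))"
      using smooth_on_differentiable smooth_F_nth by blast
    show "F (axis u t) $ i = 0" if "axis u t \<in> D" for t
    proof -
      have "F (axis u t) $ i = axis u (F (axis u t) $ u) $ i"
        using F_axis[of t] that D_subset by auto
      then show ?thesis using assms(2) by (simp add: axis_def)
    qed
  qed
  then show ?thesis using assms axis_in by (simp add: pd_F_nth)
qed

lemma pd_u_F':
  assumes "axis u s \<in> U'" "i \<noteq> u"
  shows "pd u F' (axis u s) $ i = 0"
proof -
  have s: "axis u s \<in> D'" using axis_in' assms by blast
  have "pd u (\<lambda>q. F' q $ i) (axis u s) = 0"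
  proof (rule pd_along_axis_eq_0[OF open_D' s])
    show "(\<lambda>q. F' q $ i) differentiable (at (axis u s))"
      using smooth_on_differentiable[OF smooth_on_nth[OF open_D' smooth_F'] s] .
    show "F' (axis u t) $ i = 0" if "axis u t \<in> D'" for t
    proof -
      have "F' (axis u t) $ i = axis u (F' (axis u t) $ u) $ i"
        using F'_axis[of t] that D'_subset by auto
      then show ?thesis using assms(2) by (simp add: axis_def)
    qed
  qed
  then show ?thesis using pd_nth[OF dF'[OF s]] by metis
qed

text \<open>Along the curve the u-column of the Jacobian is a multiple of the u-direction, since the
  curve is preserved. So row \<open>u\<close> of the pullback involves only row \<open>u\<close> of
  \<open>G'\<close>, whose single nonzero entry is the 1/2 in column \<open>v\<close>.\<close>

lemma metric_component:
  assumes q: "axis u s \<in> U"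
  shows "G (axis u s) $ u $ j = pd u F (axis u s) $ u * pd j F (axis u s) $ v / 2"
proof -
  let ?p = "axis u s"
  have pD: "?p \<in> D" using axis_in q by blast
  have FU: "F ?p \<in> U'" using F_in[OF pD] D'_subset by blast
  note K = adapted_form_components[OF adapted_G' uv FU sym_G'[OF FU]]
  have "G ?p $ u $ j = (\<Sum>k\<in>UNIV. \<Sum>l\<in>UNIV. pd u F ?p $ k * G' (F ?p) $ k $ l * pd j F ?p $ l)"
    using metric[OF pD] by (simp add: pullback_pd)
  also have "\<dots> = pd u F ?p $ u * pd j F ?p $ v / 2"
    using K(1,2) K(4) uv by (simp add: sum_UNIV_split[OF uv] pd_u_F[OF q])
  finally show ?thesis .
qed

text \<open>Column \<open>v\<close> of the preceding identity, where the left side is 1/2. It makes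
  both factors nonzero and each the inverse of the other.\<close>

lemma pd_u_F_u_mult: "axis u s \<in> U \<Longrightarrow> pd u F (axis u s) $ u * pd v F (axis u s) $ v = 1"
  using metric_component[of s v] adapted_form_components(2)[OF adapted_G uv _ sym_G, of "axis u s"]
  by simp

text \<open>A y-column of the same identity: the left side is 0 and the factor
  \<open>pd u F (axis u s) $ u\<close> is nonzero.\<close>

lemma pd_y_F_v: "axis u s \<in> U \<Longrightarrow> j \<notin> {u, v} \<Longrightarrow> pd j F (axis u s) $ v = 0"
  using metric_component[of s j] pd_u_F_u_mult[of s]
    adapted_form_components(4)[OF adapted_G uv _ sym_G, of "axis u s" j]
  by auto

text \<open>The vanishing just obtained holds at every point of the curve, so it can be
  differentiated along it. This supplies the second-order vanishing needed for the (v,u)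
  entry.\<close>

lemma pd_u_pd_y_F_v:
  assumes "axis u s \<in> U" "j \<notin> {u, v}"
  shows "pd u (pd j F) (axis u s) $ v = 0"
proof -
  have s: "axis u s \<in> D" using axis_in assms by blast
  have "pd u (\<lambda>q. pd j F q $ v) (axis u s) = 0"
    by (rule pd_along_axis_eq_0[OF open_D s smooth_on_differentiable[OF smooth_F_nth(2) s]])
       (use pd_y_F_v assms D_subset in blast)
  then show ?thesis by (simp add: pd_pd_F_nth[OF s])
qed

lemma chain_F'_F:
  assumes "q \<in> D"
  shows "(\<Sum>k\<in>UNIV. pd m F q $ k * pd k F' (F q) $ i) = (if i = m then 1 else 0)"
proof -
  have "((F' \<circ> F) has_derivative ((\<lambda>w. \<Sum>j\<in>UNIV. (w $ j) *\<^sub>R pd j F' (F q)) \<circ>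
       (\<lambda>w. \<Sum>j\<in>UNIV. (w $ j) *\<^sub>R pd j F q))) (at q)"
    using assms by (intro diff_chain_at has_derivative_pd dF dF' F_in)
  from pd_eqI[OF this, of m]
  have "pd m (F' \<circ> F) q = (\<Sum>k\<in>UNIV. (pd m F q $ k) *\<^sub>R pd k F' (F q))"
    by (simp add: axis_def if_distrib if_distribR cong: if_cong)
  moreover have "pd m (F' \<circ> F) q = axis m 1"
    using pd_cong[OF open_D assms, of "F' \<circ> F" "\<lambda>x. x"] F'_F by (simp add: pd_def)
  ultimately have "(\<Sum>k\<in>UNIV. (pd m F q $ k) *\<^sub>R pd k F' (F q)) $ i = axis m 1 $ i" by simp
  then show ?thesis by (auto simp: axis_def)
qed

lemma chain_F_F':
  assumes "q \<in> D'"
  shows "(\<Sum>k\<in>UNIV. pd m F' q $ k * pd k F (F' q) $ i) = (if i = m then 1 else 0)"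
proof -
  have "((F \<circ> F') has_derivative ((\<lambda>w. \<Sum>j\<in>UNIV. (w $ j) *\<^sub>R pd j F (F' q)) \<circ>
       (\<lambda>w. \<Sum>j\<in>UNIV. (w $ j) *\<^sub>R pd j F' q))) (at q)"
    using assms by (intro diff_chain_at has_derivative_pd dF dF' F'_in)
  from pd_eqI[OF this, of m]
  have "pd m (F \<circ> F') q = (\<Sum>k\<in>UNIV. (pd m F' q $ k) *\<^sub>R pd k F (F' q))"
    by (simp add: axis_def if_distrib if_distribR cong: if_cong)
  moreover have "pd m (F \<circ> F') q = axis m 1"
    using pd_cong[OF open_D' assms, of "F \<circ> F'" "\<lambda>x. x"] F_F' by (simp add: pd_def)
  ultimately have "(\<Sum>k\<in>UNIV. (pd m F' q $ k) *\<^sub>R pd k F (F' q)) $ i = axis m 1 $ i" by simp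
  then show ?thesis by (auto simp: axis_def)
qed

text \<open>In the order u, y, v the Jacobians along the curve are block triangular, so the y-block
  of the inverse is the inverse of the y-block.\<close>

lemma y_block_inverse:
  assumes s: "axis u s \<in> U" and m: "m \<notin> {u, v}" and i: "i \<notin> {u, v}"
  shows "(\<Sum>k\<in>-{u,v}. pd m F (axis u s) $ k * pd k F' (F (axis u s)) $ i) = (if i = m then 1 else 0)"
proof -
  have "pd u F' (F (axis u s)) $ i = 0"
    using pd_u_F'[OF F_axis_in[OF s], of i] F_axis[OF s] i by simp
  then show ?thesis
    using chain_F'_F[of "axis u s" m i] pd_y_F_v[OF s m] axis_in[OF s]
    by (simp add: sum_UNIV_split[OF uv])
qed

lemma y_block_inverse':
  assumes s: "axis u s \<in> U'" and m: "m \<notin> {u, v}" and i: "i \<notin> {u, v}"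
  shows "(\<Sum>k\<in>-{u,v}. pd m F' (axis u s) $ k * pd k F (F' (axis u s)) $ i) = (if i = m then 1 else 0)"
proof -
  let ?p = "F' (axis u s)"
  have sU: "axis u (?p $ u) \<in> U" and ax: "axis u (?p $ u) = ?p"
    using F'_axis_in F'_axis s by auto
  have z: "pd u F ?p $ i = 0" "pd u F ?p $ v = 0"
    using pd_u_F[OF sU] i uv by (auto simp: ax)
  \<comment> \<open>The vanishing of the y-derivatives of the v-component passes from
    \<open>F\<close> to \<open>F'\<close> through the v-component of the chain rule: only the
    summand at \<open>v\<close> survives, and its factor from \<open>F\<close> is nonzero.\<close>
  have "pd m F' (axis u s) $ v * pd v F ?p $ v = 0"
    using chain_F_F'[of "axis u s" m v] axis_in'[OF s] m z pd_y_F_v[OF sU]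
    by (auto simp: sum_UNIV_split[OF uv] ax)
  moreover have "pd v F ?p $ v \<noteq> 0"
    using pd_u_F_u_mult[OF sU] by (auto simp: ax)
  ultimately have "pd m F' (axis u s) $ v = 0" by simp
  then show ?thesis
    using chain_F_F'[of "axis u s" m i] axis_in'[OF s] z
    by (simp add: sum_UNIV_split[OF uv])
qed

text \<open>The limit of \<open>\<phi>\<^sub>\<Omega>\<inverse> \<circ> F \<circ> \<phi>\<^sub>\<Omega>\<close> as \<open>\<Omega> \<rightarrow> 0\<close>: the first-order Taylor polynomial of \<open>F\<close> at the
  curve in the \<open>y\<close>-components, the second-order one in the \<open>v\<close>-component.\<close>

definition hess :: "real^'n \<Rightarrow> real^'n \<Rightarrow> real" where
  "hess p y = (\<Sum>j\<in>-{u,v}. \<Sum>k\<in>-{u,v}. y $ j * y $ k * pd j (pd k F) p $ v) / 2"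

definition \<Phi> :: "real^'n \<Rightarrow> real^'n" where
  "\<Phi> q = (let p = axis u (q $ u) in
     \<chi> i. if i = u then F p $ u
          else if i = v then q $ v * pd v F p $ v + hess p q
          else (\<Sum>j\<in>-{u,v}. q $ j * pd j F p $ i))"

text \<open>Obtained by solving for the argument of \<open>\<Phi>\<close>: u through
  \<open>F'\<close>, y through the inverse y-block, then v by removing the quadratic shift and
  dividing by \<open>pd v F p $ v\<close>, whose inverse is \<open>pd u F p $ u\<close>.\<close>

definition \<Psi> :: "real^'n \<Rightarrow> real^'n" where
  "\<Psi> q = (let p' = axis u (q $ u); p = F' p'; y = (\<chi> i. \<Sum>j\<in>-{u,v}. q $ j * pd j F' p' $ i) in
     \<chi> i. if i = u then p $ u
          else if i = v then (q $ v - hess p y) * pd u F p $ u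
          else y $ i)"

section \<open>Domains of the limit maps, and the maps as mutual inverses\<close>

definition N where "N = {q. axis u (q $ u) \<in> U}"
definition N' where "N' = {q. axis u (q $ u) \<in> U'}"

lemma N_axis: "q \<in> N \<Longrightarrow> axis u (q $ u) \<in> D"
  using axis_in by (simp add: N_def)

lemma N'_axis: "q \<in> N' \<Longrightarrow> axis u (q $ u) \<in> D'"
  using axis_in' by (simp add: N'_def)

lemma bounded_linear_axis: "bounded_linear (\<lambda>q::real^'n. axis u (q $ u) :: real^'n)"
  unfolding linear_conv_bounded_linear[symmetric]
  by (rule linearI) (auto simp: axis_def vec_eq_iff)

lemma open_N: "open N"
  unfolding N_def using open_vimage[OF open_U, of "\<lambda>q::real^'n. axis u (q $ u)"]
    linear_continuous_on[OF bounded_linear_axis] by (simp add: vimage_def)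

lemma open_N': "open N'"
  unfolding N'_def using open_vimage[OF open_U', of "\<lambda>q::real^'n. axis u (q $ u)"]
    linear_continuous_on[OF bounded_linear_axis] by (simp add: vimage_def)

lemma \<Phi>_in: "q \<in> N \<Longrightarrow> \<Phi> q \<in> N'"
  using F_axis_in by (simp add: N_def N'_def \<Phi>_def Let_def)

lemma \<Psi>_in: "q \<in> N' \<Longrightarrow> \<Psi> q \<in> N"
  using F'_axis_in by (simp add: N_def N'_def \<Psi>_def Let_def)

text \<open>Needed because the recovered vectors \<open>y\<close> below match the intended point
  only in the y-components.\<close>

lemma hess_cong: "(\<And>j. j \<notin> {u, v} \<Longrightarrow> y $ j = z $ j) \<Longrightarrow> hess p y = hess p z"
  by (auto simp: hess_def intro!: sum.cong)

lemma \<Psi>_\<Phi>: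
  assumes q: "q \<in> N" shows "\<Psi> (\<Phi> q) = q"
proof -
  let ?p = "axis u (q $ u)"
  have pU: "?p \<in> U" using q by (simp add: N_def)
  have p': "axis u (\<Phi> q $ u) = F ?p" using F_axis[OF pU] by (simp add: \<Phi>_def Let_def)
  have F'p': "F' (F ?p) = ?p" using F'_F N_axis[OF q] by blast
  define y where "y = (\<chi> i. \<Sum>j\<in>-{u,v}. \<Phi> q $ j * pd j F' (F ?p) $ i)"
  have y: "y $ i = q $ i" if "i \<notin> {u, v}" for i
  proof -
    have "y $ i = (\<Sum>j\<in>-{u,v}. (\<Sum>m\<in>-{u,v}. q $ m * pd m F ?p $ j) * pd j F' (F ?p) $ i)"
      unfolding y_def by (auto simp: \<Phi>_def Let_def intro!: sum.cong)
    also have "\<dots> = (\<Sum>m\<in>-{u,v}. q $ m * (\<Sum>j\<in>-{u,v}. pd m F ?p $ j * pd j F' (F ?p) $ i))"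
      by (simp add: sum_distrib_left sum_distrib_right mult.assoc) (subst sum.swap, simp)
    also have "\<dots> = (\<Sum>m\<in>-{u,v}. if m = i then q $ m else 0)"
      using y_block_inverse[OF pU _ that] by (intro sum.cong) auto
    also have "\<dots> = q $ i" using that by simp
    finally show ?thesis .
  qed
  have "\<Psi> (\<Phi> q) $ i = q $ i" for i
  proof -
    have "\<Psi> (\<Phi> q) $ i = (if i = u then ?p $ u
          else if i = v then (\<Phi> q $ v - hess ?p y) * pd u F ?p $ u else y $ i)"
      unfolding \<Psi>_def Let_def p' F'p' y_def by simp
    \<comment> \<open>The two \<open>hess\<close> terms cancel, and the remaining factors multiply
      to 1 by \<open>pd_u_F_u_mult\<close>.\<close>
    moreover have "(\<Phi> q $ v - hess ?p y) * pd u F ?p $ u = q $ v"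
      using uv hess_cong[of y q ?p] y pd_u_F_u_mult[OF pU]
      by (simp add: \<Phi>_def Let_def mult.assoc mult.commute[of "pd v F ?p $ v"])
    ultimately show ?thesis using y[of i] by auto
  qed
  then show ?thesis by (simp add: vec_eq_iff)
qed

lemma \<Phi>_\<Psi>:
  assumes q: "q \<in> N'" shows "\<Phi> (\<Psi> q) = q"
proof -
  let ?p' = "axis u (q $ u)"
  let ?p = "F' ?p'"
  have p'U: "?p' \<in> U'" using q by (simp add: N'_def)
  have p: "axis u (\<Psi> q $ u) = ?p" using F'_axis[OF p'U] by (simp add: \<Psi>_def Let_def)
  have Fp: "F ?p = ?p'" using F_F' N'_axis[OF q] by blast
  have pU: "axis u (\<Psi> q $ u) \<in> U" using \<Psi>_in[OF q] by (simp add: N_def)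
  define y where "y = (\<chi> i. \<Sum>j\<in>-{u,v}. q $ j * pd j F' ?p' $ i)"
  have y: "\<Psi> q $ i = y $ i" if "i \<notin> {u, v}" for i
    using that by (simp add: \<Psi>_def Let_def y_def)
  have \<Psi>v: "\<Psi> q $ v = (q $ v - hess ?p y) * pd u F ?p $ u"
    using uv by (simp add: \<Psi>_def Let_def y_def)
  have yy: "(\<Sum>j\<in>-{u,v}. \<Psi> q $ j * pd j F ?p $ i) = q $ i" if "i \<notin> {u, v}" for i
  proof -
    have "(\<Sum>j\<in>-{u,v}. \<Psi> q $ j * pd j F ?p $ i) =
        (\<Sum>j\<in>-{u,v}. (\<Sum>m\<in>-{u,v}. q $ m * pd m F' ?p' $ j) * pd j F ?p $ i)"
      using y by (auto simp: y_def intro!: sum.cong)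
    also have "\<dots> = (\<Sum>m\<in>-{u,v}. q $ m * (\<Sum>j\<in>-{u,v}. pd m F' ?p' $ j * pd j F ?p $ i))"
      by (simp add: sum_distrib_left sum_distrib_right mult.assoc) (subst sum.swap, simp)
    also have "\<dots> = (\<Sum>m\<in>-{u,v}. if m = i then q $ m else 0)"
      using y_block_inverse'[OF p'U _ that] by (intro sum.cong) auto
    also have "\<dots> = q $ i" using that by simp
    finally show ?thesis .
  qed
  have "\<Phi> (\<Psi> q) $ i = q $ i" for i
  proof -
    have "\<Phi> (\<Psi> q) $ i = (if i = u then F ?p $ u
          else if i = v then \<Psi> q $ v * pd v F ?p $ v + hess ?p (\<Psi> q)
          else (\<Sum>j\<in>-{u,v}. \<Psi> q $ j * pd j F ?p $ i))"
      unfolding \<Phi>_def Let_def p by simp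
    moreover have "\<Psi> q $ v * pd v F ?p $ v + hess ?p (\<Psi> q) = q $ v"
      using hess_cong[of "\<Psi> q" y ?p] y pd_u_F_u_mult[OF pU] by (simp add: \<Psi>v mult.assoc p)
    ultimately show ?thesis using yy[of i] by (auto simp: Fp)
  qed
  then show ?thesis by (simp add: vec_eq_iff)
qed

section \<open>Smoothness of the limit map and its inverse\<close>

lemma smooth_along_axis:
  fixes k :: "real^'n \<Rightarrow> real"
  assumes "smooth_on D k" shows "smooth_on N (\<lambda>q. k (axis u (q $ u)))"
  using smooth_on_compose[OF open_N open_D _
      smooth_on_linear[OF open_N bounded_linear_axis smooth_on_ident] assms] N_axis
  by (auto simp: o_def)

lemma smooth_along_axis':
  fixes k :: "real^'n \<Rightarrow> 'c::real_normed_vector"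
  assumes "smooth_on D' k" shows "smooth_on N' (\<lambda>q. k (axis u (q $ u)))"
  using smooth_on_compose[OF open_N' open_D' _
      smooth_on_linear[OF open_N' bounded_linear_axis smooth_on_ident] assms] N'_axis
  by (auto simp: o_def)

text \<open>For \<open>\<Psi>\<close>, which evaluates derivatives of \<open>F\<close> at the
  preimage under \<open>F\<close> of a point of the curve.\<close>

lemma smooth_along_axis_F':
  fixes k :: "real^'n \<Rightarrow> real"
  assumes "smooth_on D k" shows "smooth_on N' (\<lambda>q. k (F' (axis u (q $ u))))"
  using smooth_on_compose[OF open_N' open_D _ smooth_along_axis'[OF smooth_F'] assms] N'_axis F'_in
  by (auto simp: o_def)

lemma smooth_\<Phi>: "smooth_on N \<Phi>"
proof (rule smooth_on_vec[OF open_N])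
  fix i
  have L: "smooth_on N (\<lambda>q. F (axis u (q $ u)) $ i)"
     "smooth_on N (\<lambda>q. pd j F (axis u (q $ u)) $ i)"
     "smooth_on N (\<lambda>q. pd k (pd j F) (axis u (q $ u)) $ i)" for i j k
    using smooth_along_axis[OF smooth_F_nth(1)] smooth_along_axis[OF smooth_F_nth(2)]
      smooth_along_axis[OF smooth_F_nth(3)] by auto
  note I = smooth_on_add smooth_on_mult smooth_on_sum open_N L smooth_on_nth[OF _ smooth_on_ident]
      smooth_on_const
  have h: "smooth_on N (\<lambda>q. hess (axis u (q $ u)) q)"
    \<comment> \<open>The division by 2 becomes a product so that the product rule among
      \<open>I\<close> applies.\<close>
    unfolding hess_def divide_inverse by (intro I)
  show "smooth_on N (\<lambda>q. \<Phi> q $ i)"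
  proof -
    consider "i = u" | "i = v" | "i \<notin> {u, v}" by blast
    then show ?thesis
      using uv by cases (simp_all add: \<Phi>_def Let_def, (intro I h)+)
  qed
qed

lemma smooth_\<Psi>: "smooth_on N' \<Psi>"
proof (rule smooth_on_vec[OF open_N'])
  fix i
  have K: "smooth_on N' (\<lambda>q. pd j F' (axis u (q $ u)) $ i)" "smooth_on N' (\<lambda>q. F' (axis u (q $ u)) $ i)" for i j
    using smooth_along_axis'[OF smooth_on_nth[OF open_D' smooth_on_pd[OF smooth_F']]]
      smooth_along_axis'[OF smooth_on_nth[OF open_D' smooth_F']] by auto
  have L: "smooth_on N' (\<lambda>q. pd j F (F' (axis u (q $ u))) $ i)"
     "smooth_on N' (\<lambda>q. pd k (pd j F) (F' (axis u (q $ u))) $ i)" for i j k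
    using smooth_along_axis_F'[OF smooth_F_nth(2)] smooth_along_axis_F'[OF smooth_F_nth(3)] by auto
  note I = smooth_on_add smooth_on_diff smooth_on_mult smooth_on_sum open_N' K L
      smooth_on_nth[OF _ smooth_on_ident] smooth_on_const
  have h: "smooth_on N' (\<lambda>q. hess (F' (axis u (q $ u)))
      (\<chi> i. \<Sum>j\<in>-{u,v}. q $ j * pd j F' (axis u (q $ u)) $ i))"
    unfolding hess_def divide_inverse vec_lambda_beta by (intro I)
  show "smooth_on N' (\<lambda>q. \<Psi> q $ i)"
  proof -
    consider "i = u" | "i = v" | "i \<notin> {u, v}" by blast
    then show ?thesis
      using uv by cases (simp_all add: \<Psi>_def Let_def, (intro I h)+)
  qed
qed

section \<open>The Jacobian of the limit map\<close>

lemma has_derivative_along_axis: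
  fixes k :: "real^'n \<Rightarrow> real"
  assumes "smooth_on D k" "q \<in> N"
  shows "((\<lambda>q. k (axis u (q $ u))) has_derivative (\<lambda>w. w $ u * pd u k (axis u (q $ u)))) (at q)"
proof -
  have "((\<lambda>q. axis u (q $ u) :: real^'n) has_derivative (\<lambda>w. axis u (w $ u))) (at q)"
    using bounded_linear_imp_has_derivative[OF bounded_linear_axis] .
  from diff_chain_at[OF this has_derivative_pd, of k]
  have "(k \<circ> (\<lambda>q. axis u (q $ u)) has_derivative
     (\<lambda>w. \<Sum>j\<in>UNIV. (w $ j) *\<^sub>R pd j k (axis u (q $ u))) \<circ> (\<lambda>w. axis u (w $ u))) (at q)"
    using smooth_on_differentiable[OF assms(1) N_axis[OF assms(2)]] .
  then show ?thesis
    by (simp add: o_def axis_def if_distrib if_distribR cong: if_cong)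
qed

lemma has_derivative_nth: "((\<lambda>q::real^'n. q $ i) has_derivative (\<lambda>w. w $ i)) (at q)"
  by (rule bounded_linear_imp_has_derivative[OF bounded_linear_vec_nth])

lemma pd_\<Phi>_nth: "q \<in> N \<Longrightarrow> pd j \<Phi> q $ i = pd j (\<lambda>q. \<Phi> q $ i) q"
  using pd_nth[OF smooth_on_differentiable[OF smooth_\<Phi>]] by metis

lemma pd_\<Phi>_u:
  assumes "q \<in> N"
  shows "pd j \<Phi> q $ u = (if j = u then pd u F (axis u (q $ u)) $ u else 0)"
proof -
  have "((\<lambda>q. \<Phi> q $ u) has_derivative (\<lambda>w. w $ u * pd u F (axis u (q $ u)) $ u)) (at q)"
    using has_derivative_along_axis[OF smooth_F_nth(1)[of u] assms] pd_F_nth[OF N_axis[OF assms]]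
    by (simp add: \<Phi>_def Let_def)
  from pd_eqI[OF this, of j] show ?thesis by (simp add: pd_\<Phi>_nth[OF assms] axis_def)
qed

lemma pd_\<Phi>_y:
  assumes q: "q \<in> N" and i: "i \<notin> {u, v}"
  shows "pd j \<Phi> q $ i = (if j = u then (\<Sum>m\<in>-{u,v}. q $ m * pd u (pd m F) (axis u (q $ u)) $ i)
     else if j = v then 0 else pd j F (axis u (q $ u)) $ i)"
proof -
  let ?p = "axis u (q $ u)"
  have "((\<lambda>q. \<Sum>m\<in>-{u,v}. q $ m * pd m F (axis u (q $ u)) $ i) has_derivative
     (\<lambda>w. \<Sum>m\<in>-{u,v}. q $ m * (w $ u * pd u (\<lambda>p. pd m F p $ i) ?p) + w $ m * pd m F ?p $ i)) (at q)"
    by (intro has_derivative_sum has_derivative_mult has_derivative_nth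
        has_derivative_along_axis[OF smooth_F_nth(2) q])
  moreover have "(\<lambda>q. \<Phi> q $ i) = (\<lambda>q. \<Sum>m\<in>-{u,v}. q $ m * pd m F (axis u (q $ u)) $ i)"
    using i by (auto simp: \<Phi>_def Let_def)
  ultimately have "((\<lambda>q. \<Phi> q $ i) has_derivative
     (\<lambda>w. \<Sum>m\<in>-{u,v}. q $ m * (w $ u * pd u (pd m F) ?p $ i) + w $ m * pd m F ?p $ i)) (at q)"
    by (simp only: pd_pd_F_nth[OF N_axis[OF q]])
  from pd_eqI[OF this, of j] have "pd j (\<lambda>q. \<Phi> q $ i) q =
     (\<Sum>m\<in>-{u,v}. q $ m * (axis j 1 $ u * pd u (pd m F) ?p $ i) + axis j 1 $ m * pd m F ?p $ i)"
    .
  also have "\<dots> = (\<Sum>m\<in>-{u,v}. (if j = u then q $ m * pd u (pd m F) ?p $ i else 0) +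
       (if m = j then pd j F ?p $ i else 0))"
    by (rule sum.cong) (auto simp: axis_def)
  also have "\<dots> = (if j = u then (\<Sum>m\<in>-{u,v}. q $ m * pd u (pd m F) ?p $ i)
     else if j = v then 0 else pd j F ?p $ i)"
    by (simp add: sum.distrib)
  finally show ?thesis by (simp add: pd_\<Phi>_nth[OF q])
qed

text \<open>A y-derivative hits either factor of the quadratic form; by symmetry of the second
  derivatives the two contributions agree and absorb the 1/2. In the u-direction only the
  coefficients vary, which brings in third derivatives of \<open>F\<close>.\<close>

lemma pd_\<Phi>_v:
  assumes q: "q \<in> N"
  defines "p \<equiv> axis u (q $ u)"
  shows "pd j \<Phi> q $ v =
    (if j = u then q $ v * pd u (pd v F) p $ v +
        (\<Sum>k\<in>-{u,v}. \<Sum>m\<in>-{u,v}. q $ k * q $ m * pd u (pd k (pd m F)) p $ v) / 2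
     else if j = v then pd v F p $ v
     else (\<Sum>m\<in>-{u,v}. q $ m * pd m (pd j F) p $ v))"
proof -
  have pD: "p \<in> D" using N_axis[OF q] by (simp add: p_def)
  have nth3: "pd u (\<lambda>p. pd k (pd m F) p $ v) p = pd u (pd k (pd m F)) p $ v" for k m
    by (intro pd_nth smooth_on_differentiable[OF _ pD] smooth_on_pd smooth_F)
  have "((\<lambda>q. q $ v * pd v F (axis u (q $ u)) $ v + (1 / 2) *
       (\<Sum>k\<in>-{u,v}. \<Sum>m\<in>-{u,v}. q $ k * q $ m * pd k (pd m F) (axis u (q $ u)) $ v)) has_derivative
     (\<lambda>w. (q $ v * (w $ u * pd u (\<lambda>p. pd v F p $ v) p) + w $ v * pd v F p $ v) +
       (1 / 2) * (\<Sum>k\<in>-{u,v}. \<Sum>m\<in>-{u,v}. (q $ k * q $ m) * (w $ u * pd u (\<lambda>p. pd k (pd m F) p $ v) p) +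
         (q $ k * w $ m + w $ k * q $ m) * pd k (pd m F) p $ v))) (at q)"
    unfolding p_def
    by (intro has_derivative_add has_derivative_sum has_derivative_mult has_derivative_nth
        has_derivative_mult_right
        has_derivative_along_axis[OF smooth_F_nth(2) q] has_derivative_along_axis[OF smooth_F_nth(3) q])
  moreover have "(\<lambda>q. \<Phi> q $ v) = (\<lambda>q. q $ v * pd v F (axis u (q $ u)) $ v + (1 / 2) *
       (\<Sum>k\<in>-{u,v}. \<Sum>m\<in>-{u,v}. q $ k * q $ m * pd k (pd m F) (axis u (q $ u)) $ v))"
    using uv by (auto simp: \<Phi>_def Let_def hess_def)
  ultimately have "((\<lambda>q. \<Phi> q $ v) has_derivative
     (\<lambda>w. (q $ v * (w $ u * pd u (pd v F) p $ v) + w $ v * pd v F p $ v) +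
       (1 / 2) * (\<Sum>k\<in>-{u,v}. \<Sum>m\<in>-{u,v}. (q $ k * q $ m) * (w $ u * pd u (pd k (pd m F)) p $ v) +
         (q $ k * w $ m + w $ k * q $ m) * pd k (pd m F) p $ v))) (at q)"
    by (simp only: nth3 pd_pd_F_nth[OF pD])
  from pd_eqI[OF this, of j]
  have *: "pd j (\<lambda>q. \<Phi> q $ v) q =
     (q $ v * (axis j 1 $ u * pd u (pd v F) p $ v) + axis j 1 $ v * pd v F p $ v) +
       (1 / 2) * (\<Sum>k\<in>-{u,v}. \<Sum>m\<in>-{u,v}. (q $ k * q $ m) * (axis j 1 $ u * pd u (pd k (pd m F)) p $ v) +
         (q $ k * axis j 1 $ m + axis j 1 $ k * q $ m) * pd k (pd m F) p $ v)" .
  have com: "pd k (pd m F) p = pd m (pd k F) p" for k m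
    by (rule pd_commute[OF open_D smooth_F pD])
  consider "j = u" | "j = v" | "j \<notin> {u, v}" by blast
  then show ?thesis
  proof cases
    case 1
    then show ?thesis
      unfolding pd_\<Phi>_nth[OF q] * using uv
      by (auto simp: axis_def sum_divide_distrib sum_distrib_left intro!: sum.cong)
  next
    case 2
    then show ?thesis
      unfolding pd_\<Phi>_nth[OF q] * using uv by (auto simp: axis_def intro!: sum.neutral)
  next
    case 3
    have ax: "axis j (1::real) $ u = 0" "axis j (1::real) $ v = 0"
      using 3 by (auto simp: axis_def)
    \<comment> \<open>The two Kronecker terms are kept apart; after exchanging the derivatives in
      the second one, both sum to the same value.\<close>
    have "(q $ k * axis j 1 $ m + axis j 1 $ k * q $ m) * pd k (pd m F) p $ v =
       (if m = j then q $ k * pd k (pd j F) p $ v else 0) +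
       (if k = j then q $ m * pd m (pd j F) p $ v else 0)" for k m
      using com[of m j] by (simp add: axis_def algebra_simps)
    then have "pd j (\<lambda>q. \<Phi> q $ v) q =
       (1 / 2) * (\<Sum>k\<in>-{u,v}. \<Sum>m\<in>-{u,v}. (if m = j then q $ k * pd k (pd j F) p $ v else 0) +
          (if k = j then q $ m * pd m (pd j F) p $ v else 0))"
      unfolding * ax by simp
    also have "\<dots> = (\<Sum>m\<in>-{u,v}. q $ m * pd m (pd j F) p $ v)"
    proof -
      have "(\<Sum>k\<in>-{u,v}. \<Sum>m\<in>-{u,v}. if k = j then q $ m * pd m (pd j F) p $ v else 0) =
          (\<Sum>m\<in>-{u,v}. \<Sum>k\<in>-{u,v}. if k = j then q $ m * pd m (pd j F) p $ v else 0)"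
        by (rule sum.swap)
      then show ?thesis using 3 by (simp add: sum.distrib)
    qed
    finally show ?thesis using 3 by (simp add: pd_\<Phi>_nth[OF q])
  qed
qed

section \<open>Convergence of the rescaled Jacobian and of the metric identity\<close>

text \<open>Continuity suffices on the diagonal blocks and for (u,v), (u,y), (y,v), where a positive
  power of \<Omega> gives 0. The entries (y,u) and (v,y) vanish on the curve and use the first-order
  expansion, (v,u) the second-order one. The limits are then matched with the explicit Jacobian of
  \<open>\<Phi>\<close>.\<close>

lemma tendsto_rescaled_derivative:
  assumes q: "q \<in> N"
  shows "((\<lambda>\<Omega>. scaling_weight u v \<Omega> j / scaling_weight u v \<Omega> i *
      pd j F (penrose_scaling u v \<Omega> q) $ i) \<longlongrightarrow> pd j \<Phi> q $ i) (at_right 0)"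
proof -
  let ?c = "\<lambda>\<Omega>. penrose_scaling u v \<Omega> q"
  define p where "p = axis u (q $ u)"
  have pU: "p \<in> U" and pD: "p \<in> D" using q N_axis[OF q] by (simp_all add: N_def p_def)
  have c: "(?c \<longlongrightarrow> p) (at_right 0)"
    unfolding p_def using tendsto_penrose_scaling by (rule filterlim_mono) (auto simp: at_le)
  have "((\<lambda>\<Omega>. g (?c \<Omega>)) \<longlongrightarrow> g p) (at_right 0)" if "smooth_on D g" for g :: "real^'n \<Rightarrow> real"
    using smooth_on_continuous[OF that] open_D pD c
    by (metis continuous_on_eq_continuous_at isCont_tendsto_compose)
  then have c0: "((\<lambda>\<Omega>. pd j F (?c \<Omega>) $ i) \<longlongrightarrow> pd j F p $ i) (at_right 0)" for i j
    using smooth_F_nth(2) by blast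
  have \<Omega>: "((\<lambda>\<Omega>::real. \<Omega>) \<longlongrightarrow> 0) (at_right 0)" by (rule tendsto_ident_at)
  have com: "pd k (pd m F) p = pd m (pd k F) p" for k m
    by (rule pd_commute[OF open_D smooth_F pD])
  have c1: "((\<lambda>\<Omega>. pd j F (?c \<Omega>) $ i / \<Omega>) \<longlongrightarrow> (\<Sum>m\<in>-{u,v}. q $ m * pd m (pd j F) p $ i)) (at_right 0)"
    if "pd j F p $ i = 0" for i j
    using tendsto_first_order[OF uv, of "\<lambda>x. pd j F x $ i" q] that
      smooth_on_differentiable[OF smooth_F_nth(2) pD]
    by (simp add: p_def[symmetric] pd_pd_F_nth[OF pD])
  have c2: "((\<lambda>\<Omega>. pd u F (?c \<Omega>) $ v / \<Omega>\<^sup>2) \<longlongrightarrow> pd u \<Phi> q $ v) (at_right 0)"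
  proof -
    \<comment> \<open>The expansion produces third derivatives with \<open>u\<close> innermost,
      whereas \<open>pd_\<Phi>_v\<close> has \<open>u\<close> outermost.\<close>
    have third: "pd k (pd m (\<lambda>x. pd u F x $ v)) p = pd u (pd k (pd m F)) p $ v" for k m
    proof -
      have "pd k (pd m (\<lambda>x. pd u F x $ v)) p = pd k (\<lambda>x. pd u (pd m F) x $ v) p"
        by (rule pd_cong[OF open_D pD]) (simp add: pd_pd_F_nth pd_commute[OF open_D smooth_F])
      also have "\<dots> = pd k (pd u (pd m F)) p $ v"
        by (intro pd_nth smooth_on_differentiable[OF _ pD] smooth_on_pd smooth_F)
      also have "\<dots> = pd u (pd k (pd m F)) p $ v"
        by (simp add: pd_commute[OF open_D smooth_on_pd[OF smooth_F] pD])
      finally show ?thesis .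
    qed
    \<comment> \<open>The extra hypothesis of the second-order expansion.\<close>
    have "pd m (pd u F) p $ v = 0" if "m \<notin> {u, v}" for m
      using pd_u_pd_y_F_v[OF pU[unfolded p_def] that] by (simp add: com[of m u] p_def[symmetric])
    then show ?thesis
      using tendsto_second_order[OF uv open_D smooth_F_nth(2)[of u v], of q] pD
        pd_u_F[OF pU[unfolded p_def], of v] uv
      by (simp add: p_def[symmetric] pd_pd_F_nth[OF pD] third pd_\<Phi>_v[OF q] com[of v u])
  qed
  have ev: "\<forall>\<^sub>F \<Omega> in at_right 0. \<Omega> > (0::real)" by (rule eventually_at_right_less)
  \<comment> \<open>The weights may be simplified for positive \<Omega> only, which is all that a
    right-hand limit sees.\<close>
  have ?thesis if "((\<lambda>\<Omega>. g \<Omega>) \<longlongrightarrow> pd j \<Phi> q $ i) (at_right 0)"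
      "\<And>\<Omega>. \<Omega> > 0 \<Longrightarrow> scaling_weight u v \<Omega> j / scaling_weight u v \<Omega> i * pd j F (?c \<Omega>) $ i = g \<Omega>" for g
    by (rule tendsto_cong[THEN iffD2, OF _ that(1)]) (rule eventually_mono[OF ev that(2)])
  note by_formula = this
  note w = scaling_weight_def
  have \<Omega>0: "((\<lambda>\<Omega>. \<Omega> * pd j F (?c \<Omega>) $ i) \<longlongrightarrow> 0) (at_right 0)"
    "((\<lambda>\<Omega>. \<Omega> * (\<Omega> * pd j F (?c \<Omega>) $ i)) \<longlongrightarrow> 0) (at_right 0)"
    using tendsto_mult[OF \<Omega> c0] tendsto_mult[OF \<Omega> tendsto_mult[OF \<Omega> c0]] by simp_all
  consider "i = u" "j = u" | "i = u" "j = v" | "i = u" "j \<notin> {u, v}"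
    | "i = v" "j = u" | "i = v" "j = v" | "i = v" "j \<notin> {u, v}"
    | "i \<notin> {u, v}" "j = u" | "i \<notin> {u, v}" "j = v" | "i \<notin> {u, v}" "j \<notin> {u, v}"
    by blast
  then show ?thesis
  proof cases
    case 1
    then show ?thesis using c0 by (simp add: w pd_\<Phi>_u[OF q] p_def)
  next
    case 2
    then show ?thesis
      using \<Omega>0(2) uv by (simp add: w pd_\<Phi>_u[OF q] power2_eq_square mult.assoc)
  next
    case 3
    then show ?thesis using \<Omega>0(1) by (simp add: w pd_\<Phi>_u[OF q])
  next
    case 4
    then show ?thesis using c2 uv by (simp add: w)
  next
    case 5
    show ?thesis
      by (rule by_formula[OF _ ]) (use 5 c0 uv in \<open>auto simp: w pd_\<Phi>_v[OF q] p_def[symmetric]\<close>)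
  next
    case 6
    then show ?thesis
      by (intro by_formula[where g = "\<lambda>\<Omega>. pd j F (?c \<Omega>) $ i / \<Omega>"])
        (use 6 c1[of j v] pd_y_F_v[OF pU[unfolded p_def]] uv in
          \<open>auto simp: w pd_\<Phi>_v[OF q] p_def[symmetric] power2_eq_square\<close>)
  next
    case 7
    then show ?thesis
      using c1[of u i] pd_u_F[OF pU[unfolded p_def], of i] uv
      by (simp add: w pd_\<Phi>_y[OF q] p_def[symmetric] com[of _ u])
  next
    case 8
    show ?thesis
      by (rule by_formula[where g = "\<lambda>\<Omega>. \<Omega> * pd j F (?c \<Omega>) $ i"])
        (use 8 \<Omega>0(1) uv in \<open>auto simp: w pd_\<Phi>_y[OF q] power2_eq_square\<close>)
  next
    case 9
    show ?thesis
      by (rule by_formula[where g = "\<lambda>\<Omega>. pd j F (?c \<Omega>) $ i"])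
        (use 9 c0 in \<open>auto simp: w pd_\<Phi>_y[OF q] p_def[symmetric]\<close>)
  qed
qed

text \<open>The isometry identity at the scaled point is multiplied by the weights of
  \<open>i\<close> and \<open>j\<close> over \<open>\<Omega>\<^sup>2\<close>. Distributing the
  weights of the summation indices over the factors makes each factor converge separately.\<close>

lemma plane_wave_pullback:
  assumes q: "q \<in> N"
  shows "plane_wave u v G (q $ u) $ i $ j =
    (\<Sum>k\<in>UNIV. \<Sum>l\<in>UNIV. pd i \<Phi> q $ k * plane_wave u v G' (\<Phi> q $ u) $ k $ l * pd j \<Phi> q $ l)"
proof -
  let ?c = "\<lambda>\<Omega>. penrose_scaling u v \<Omega> q" and ?p = "axis u (q $ u)"
  let ?w = "scaling_weight u v"
  have pU: "?p \<in> U" and pD: "?p \<in> D" using q N_axis[OF q] by (simp_all add: N_def)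
  have c: "(?c \<longlongrightarrow> ?p) (at_right 0)"
    using tendsto_penrose_scaling by (rule filterlim_mono) (auto simp: at_le)
  have "isCont F ?p" using dF[OF pD] by (rule differentiable_imp_continuous_within)
  then have "((\<lambda>\<Omega>. F (?c \<Omega>)) \<longlongrightarrow> F ?p) (at_right 0)" using c by (rule isCont_tendsto_compose)
  then have Fc: "((\<lambda>\<Omega>. F (?c \<Omega>)) \<longlongrightarrow> axis u (\<Phi> q $ u)) (at_right 0)"
    using F_axis[OF pU] by (simp add: \<Phi>_def Let_def)
  have p'U: "axis u (\<Phi> q $ u) \<in> U'" using \<Phi>_in[OF q] by (simp add: N'_def)
  have 1: "((\<lambda>\<Omega>. ?w \<Omega> i * ?w \<Omega> j / \<Omega>\<^sup>2 * G (?c \<Omega>) $ i $ j) \<longlongrightarrow>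
      plane_wave u v G (q $ u) $ i $ j) (at_right 0)"
    by (rule tendsto_scaled_metric[OF adapted_G uv open_U cont_G sym_G pU c])
  have 2: "((\<lambda>\<Omega>. \<Sum>k\<in>UNIV. \<Sum>l\<in>UNIV. (?w \<Omega> i / ?w \<Omega> k * pd i F (?c \<Omega>) $ k) *
         (?w \<Omega> k * ?w \<Omega> l / \<Omega>\<^sup>2 * G' (F (?c \<Omega>)) $ k $ l) * (?w \<Omega> j / ?w \<Omega> l * pd j F (?c \<Omega>) $ l)) \<longlongrightarrow>
       (\<Sum>k\<in>UNIV. \<Sum>l\<in>UNIV. pd i \<Phi> q $ k * plane_wave u v G' (\<Phi> q $ u) $ k $ l * pd j \<Phi> q $ l)) (at_right 0)"
    by (intro tendsto_sum tendsto_mult tendsto_rescaled_derivative[OF q]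
        tendsto_scaled_metric[OF adapted_G' uv open_U' cont_G' sym_G' p'U Fc])
  have "\<forall>\<^sub>F \<Omega> in at_right 0. ?c \<Omega> \<in> D \<and> \<Omega> > 0"
    using topological_tendstoD[OF c open_D pD] eventually_at_right_less[of "0::real"]
    by eventually_elim auto
  then have "\<forall>\<^sub>F \<Omega> in at_right 0. ?w \<Omega> i * ?w \<Omega> j / \<Omega>\<^sup>2 * G (?c \<Omega>) $ i $ j =
     (\<Sum>k\<in>UNIV. \<Sum>l\<in>UNIV. (?w \<Omega> i / ?w \<Omega> k * pd i F (?c \<Omega>) $ k) *
         (?w \<Omega> k * ?w \<Omega> l / \<Omega>\<^sup>2 * G' (F (?c \<Omega>)) $ k $ l) * (?w \<Omega> j / ?w \<Omega> l * pd j F (?c \<Omega>) $ l))"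
  proof eventually_elim
    case (elim \<Omega>)
    then have w: "?w \<Omega> k \<noteq> 0" for k by (simp add: scaling_weight_def)
    have "G (?c \<Omega>) $ i $ j = (\<Sum>k\<in>UNIV. \<Sum>l\<in>UNIV. pd i F (?c \<Omega>) $ k *
        G' (F (?c \<Omega>)) $ k $ l * pd j F (?c \<Omega>) $ l)"
      using metric[of "?c \<Omega>"] elim by (simp add: pullback_pd)
    \<comment> \<open>The weights of \<open>k\<close> and \<open>l\<close> are inserted and cancel;
      this is the conjugation of \<open>F\<close> by the scaling, entry by entry.\<close>
    moreover have "?w \<Omega> i * ?w \<Omega> j / \<Omega>\<^sup>2 * (a * b * c) =
        (?w \<Omega> i / ?w \<Omega> k * a) * (?w \<Omega> k * ?w \<Omega> l / \<Omega>\<^sup>2 * b) * (?w \<Omega> j / ?w \<Omega> l * c)" for k l a b c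
      using w by simp
    ultimately show ?case by (simp only: sum_distrib_left)
  qed
  from 1[unfolded tendsto_cong[OF this]] 2 show ?thesis
    by (rule tendsto_unique[rotated]) simp
qed

lemma penrose_metric_pullback:
  assumes q: "q \<in> N"
  shows "penrose_metric u v G q = pullback \<Phi> (penrose_metric u v G') q"
proof -
  have "axis u (q $ u) \<in> U" "axis u (\<Phi> q $ u) \<in> U'"
    using q \<Phi>_in[OF q] by (simp_all add: N_def N'_def)
  then show ?thesis
    using plane_wave_pullback[OF q]
    by (simp add: vec_eq_iff pullback_pd
        penrose_metric_eq_plane_wave[OF adapted_G uv open_U cont_G sym_G]
        penrose_metric_eq_plane_wave[OF adapted_G' uv open_U' cont_G' sym_G'])
qed

end

section \<open>Charts and pullbacks\<close>

lemma pullback_compose: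
  assumes "\<sigma> differentiable (at q)" "\<tau> differentiable (at (\<sigma> q))"
  shows "pullback \<sigma> (pullback \<tau> h) q = pullback (\<tau> \<circ> \<sigma>) h q"
proof -
  have "frechet_derivative (\<tau> \<circ> \<sigma>) (at q) = frechet_derivative \<tau> (at (\<sigma> q)) \<circ> frechet_derivative \<sigma> (at q)"
    using assms by (rule frechet_derivative_compose)
  then have "matrix (frechet_derivative (\<tau> \<circ> \<sigma>) (at q)) =
      matrix (frechet_derivative \<tau> (at (\<sigma> q))) ** matrix (frechet_derivative \<sigma> (at q))"
    using assms by (simp add: matrix_compose linear_frechet_derivative)
  then show ?thesis
    by (simp add: pullback_def Let_def matrix_transpose_mul matrix_mul_assoc)
qed

lemma pullback_cong:
  assumes "open S" "q \<in> S" "\<And>p. p \<in> S \<Longrightarrow> \<sigma> p = \<tau> p" "h (\<tau> q) = h' (\<tau> q)"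
  shows "pullback \<sigma> h q = pullback \<tau> h' q"
  using frechet_derivative_cong_open[OF assms(1-3)] assms by (simp add: pullback_def)

lemma pullback_ident:
  fixes h :: "real^'n \<Rightarrow> real^'n^'n"
  shows "pullback (\<lambda>x. x) h q = h q"
proof -
  have "matrix (\<lambda>x. x) = (mat 1 :: real^'n^'n)"
    by (auto simp: matrix_def mat_def axis_def vec_eq_iff)
  then show ?thesis by (simp add: pullback_def Let_def transpose_mat)
qed

text \<open>The adapted form prescribes only the quadratic form of the metric; symmetry is what
  recovers the matrix entries from it. It is inherited from the diagonal matrix
  \<open>minkowski k\<close> by cancelling the invertible \<open>P\<close>.\<close>

lemma lorentzian_form_symmetric:
  fixes A :: "real^'n^'n"
  assumes "lorentzian_form A" shows "transpose A = A"
proof -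
  obtain P :: "real^'n^'n" and k where P: "invertible P" "transpose P ** A ** P = minkowski k"
    using assms by (auto simp: lorentzian_form_def)
  obtain Q where Q: "P ** Q = mat 1" using P(1) by (auto simp: invertible_def)
  have Q': "transpose Q ** transpose P = mat 1"
    using Q by (simp add: matrix_transpose_mul[symmetric] transpose_mat)
  have A: "B = transpose Q ** (transpose P ** B ** P) ** Q" for B :: "real^'n^'n"
    by (metis Q Q' matrix_mul_assoc matrix_mul_lid matrix_mul_rid)
  have "transpose (minkowski k) = minkowski k"
    by (auto simp: minkowski_def transpose_def vec_eq_iff)
  then have "transpose P ** transpose A ** P = transpose P ** A ** P"
    using P(2) by (metis matrix_mul_assoc matrix_transpose_mul transpose_transpose)
  then show ?thesis using A[of A] A[of "transpose A"] by simp
qed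

lemma is_chart_inj: "is_chart X (W, x) \<Longrightarrow> inj_on x W"
  unfolding is_chart_def using homeomorphic_imp_injective_map openin_subset
  by (fastforce simp: Int_absorb1)

lemma is_chart_open_image:
  assumes "is_chart X (W, x)" "openin X V" "V \<subseteq> W"
  shows "open (x ` V)"
proof -
  have h: "homeomorphic_map (subtopology X W) (top_of_set (x ` W)) x" and o: "open (x ` W)"
    using assms(1) by (auto simp: is_chart_def)
  have "openin (subtopology X W) V" using assms by (metis openin_subtopology inf.absorb_iff1)
  then have "openin (top_of_set (x ` W)) (x ` V)"
    using homeomorphic_imp_open_map[OF h] by (simp add: open_map_def)
  then show ?thesis using o openin_open_trans by blast
qed

section \<open>Restriction of charts and of the metric\<close>

text \<open>By maximality of the atlas. An adapted chart may stick out of the tubular neighbourhood,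
  while the given isometry speaks only of charts inside it.\<close>

lemma atlas_restrict:
  assumes M: "smooth_manifold M" and c: "(W, x) \<in> atlas M" and T: "openin (top_of M) T"
  shows "(W \<inter> T, x) \<in> atlas M"
proof -
  have ch: "is_chart (top_of M) d" if "d \<in> atlas M" for d
    using M that by (simp add: smooth_manifold_def)
  have comp: "compatible d e" if "d \<in> atlas M" "e \<in> atlas M" for d e
    using M that by (simp add: smooth_manifold_def)
  have maximal: "d \<in> atlas M" if "is_chart (top_of M) d" "\<And>e. e \<in> atlas M \<Longrightarrow> compatible d e" for d
    using M that unfolding smooth_manifold_def by blast
  have W: "openin (top_of M) W" using ch[OF c] by (simp add: is_chart_def)
  have h: "homeomorphic_map (subtopology (top_of M) W) (top_of_set (x ` W)) x"
    using ch[OF c] by (simp add: is_chart_def)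
  have "homeomorphic_map (subtopology (subtopology (top_of M) W) (W \<inter> T))
      (subtopology (top_of_set (x ` W)) (x ` (W \<inter> T))) x"
    using openin_subset[OF W] by (intro homeomorphic_map_subtopologies[OF h]) auto
  moreover have "subtopology (top_of_set (x ` W)) (x ` (W \<inter> T)) = top_of_set (x ` (W \<inter> T))"
    by (simp add: subtopology_subtopology Int_absorb1 image_mono)
  ultimately have "is_chart (top_of M) (W \<inter> T, x)"
    using is_chart_open_image[OF ch[OF c]] W T
    by (simp add: is_chart_def subtopology_subtopology openin_Int Int_absorb1)
  moreover have "compatible (W \<inter> T, x) d" if d: "d \<in> atlas M" for d
  proof -
    obtain V y where [simp]: "d = (V, y)" by (cases d)
    have V: "openin (top_of M) V" using ch[OF d] by (simp add: is_chart_def)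
    have s: "smooth_on (x ` (W \<inter> V)) (y \<circ> inv_into W x)" "smooth_on (y ` (V \<inter> W)) (x \<circ> inv_into V y)"
      using comp[OF c d] by (simp_all add: compatible_def smooth_transition_def)
    have "open (x ` (W \<inter> T \<inter> V))"
      using W T V by (intro is_chart_open_image[OF ch[OF c]]) auto
    \<comment> \<open>\<open>inv_into\<close> depends on its domain, so the two inverses are
      compared on the smaller image, where injectivity makes them agree.\<close>
    moreover have "(y \<circ> inv_into W x) q = (y \<circ> inv_into (W \<inter> T) x) q" if "q \<in> x ` (W \<inter> T \<inter> V)" for q
    proof -
      have "inj_on x W" "inj_on x (W \<inter> T)"
        using is_chart_inj[OF ch[OF c]] by (auto intro: inj_on_subset)
      then show ?thesis using that by (auto simp: inv_into_f_f)
    qed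
    moreover have "smooth_on (x ` (W \<inter> T \<inter> V)) (y \<circ> inv_into W x)"
      by (rule smooth_on_subset[OF s(1)]) auto
    ultimately have "smooth_on (x ` (W \<inter> T \<inter> V)) (y \<circ> inv_into (W \<inter> T) x)"
      by (rule smooth_on_cong[THEN iffD1])
    moreover have "smooth_on (y ` (V \<inter> (W \<inter> T))) (x \<circ> inv_into V y)"
      by (rule smooth_on_subset[OF s(2)]) auto
    ultimately show ?thesis by (simp add: compatible_def smooth_transition_def)
  qed
  ultimately show ?thesis by (rule maximal)
qed

text \<open>The components in the restricted chart are separate data of the record; they agree with
  the old ones by the transformation law, the transition map being the identity.\<close>

lemma metric_restrict:
  assumes M: "lorentzian_manifold M" and c: "(W, x) \<in> atlas M" and T: "openin (top_of M) T"
    and q: "q \<in> x ` (W \<inter> T)"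
  shows "metric M (W \<inter> T, x) q = metric M (W, x) q"
proof -
  have m: "smooth_manifold M" using M by (simp add: lorentzian_manifold_def)
  note r = atlas_restrict[OF m c T]
  have ch: "is_chart (top_of M) (W \<inter> T, x)" using m r by (simp add: smooth_manifold_def)
  then have o: "open (x ` (W \<inter> T))" by (simp add: is_chart_def)
  have "metric M (W \<inter> T, x) q = pullback (x \<circ> inv_into (W \<inter> T) x) (metric M (W, x)) q"
    using M c r q unfolding lorentzian_manifold_def by fastforce
  also have "\<dots> = pullback (\<lambda>q. q) (metric M (W, x)) q"
    by (rule pullback_cong[OF o q]) (auto simp: f_inv_into_f)
  finally show ?thesis by (simp add: pullback_ident)
qed

section \<open>Isometries between coordinate domains\<close>

lemma smooth_in_charts:
  fixes \<Phi> x x' :: "real^'n \<Rightarrow> real^'n"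
  assumes "open W" "open W'" "open (x ` W)" "inj_on x W"
    and "smooth_on (x ` W) (inv_into W x)" "smooth_on W' x'" "smooth_on W \<Phi>"
  shows "open (x ` (W \<inter> \<Phi> -` W'))" "smooth_on (x ` (W \<inter> \<Phi> -` W')) (x' \<circ> \<Phi> \<circ> inv_into W x)"
proof -
  have V: "open (W \<inter> \<Phi> -` W')"
    using continuous_open_preimage[OF smooth_on_continuous[OF assms(7)]] assms by blast
  \<comment> \<open>Rewritten as a preimage under the inverse chart, so that continuity yields
    openness.\<close>
  have "x ` (W \<inter> \<Phi> -` W') = x ` W \<inter> inv_into W x -` (W \<inter> \<Phi> -` W')"
    using assms(4) by (auto simp: inv_into_f_f)
  then show S: "open (x ` (W \<inter> \<Phi> -` W'))"
    using continuous_open_preimage[OF smooth_on_continuous[OF assms(5)] assms(3) V] by simp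
  have "smooth_on (x ` (W \<inter> \<Phi> -` W')) (\<Phi> \<circ> inv_into W x)"
    by (rule smooth_on_compose[OF S V])
       (use assms in \<open>auto simp: inv_into_f_f intro: smooth_on_subset\<close>)
  moreover have "(\<Phi> \<circ> inv_into W x) ` x ` (W \<inter> \<Phi> -` W') \<subseteq> W'"
    using assms(4) by (auto simp: inv_into_f_f)
  ultimately have "smooth_on (x ` (W \<inter> \<Phi> -` W')) (x' \<circ> (\<Phi> \<circ> inv_into W x))"
    using smooth_on_compose[OF S assms(2)] assms(6) by blast
  then show "smooth_on (x ` (W \<inter> \<Phi> -` W')) (x' \<circ> \<Phi> \<circ> inv_into W x)"
    by (simp only: o_assoc)
qed

text \<open>It is enough to check the metric identity in the standard coordinates: the metric in any
  other chart is a pullback along the inverse chart, and pullbacks compose.\<close>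

lemma isometry_coordinate_manifold:
  fixes \<Phi> \<Psi> :: "real^'n \<Rightarrow> real^'n"
  assumes N: "open N" and N': "open N'"
    and \<Phi>: "smooth_on N \<Phi>" "\<And>q. q \<in> N \<Longrightarrow> \<Phi> q \<in> N'" and \<Psi>: "smooth_on N' \<Psi>" "\<And>q. q \<in> N' \<Longrightarrow> \<Psi> q \<in> N"
    and \<Psi>\<Phi>: "\<And>q. q \<in> N \<Longrightarrow> \<Psi> (\<Phi> q) = q" and \<Phi>\<Psi>: "\<And>q. q \<in> N' \<Longrightarrow> \<Phi> (\<Psi> q) = q"
    and h: "\<And>q. q \<in> N \<Longrightarrow> h q = pullback \<Phi> h' q"
  shows "isometry (coordinate_manifold N h) (coordinate_manifold N' h') \<Phi>"
proof -
  let ?M = "coordinate_manifold N h" and ?M' = "coordinate_manifold N' h'"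
  have chartD: "open W" "W \<subseteq> N" "open (x ` W)" "inj_on x W" "smooth_on W x"
      "smooth_on (x ` W) (inv_into W x)"
    if c: "(W, x) \<in> atlas (coordinate_manifold N h)" and o: "open N" for W x N and h :: "real^'n \<Rightarrow> real^'n^'n"
  proof -
    have ch: "is_chart (top_of_set N) (W, x)" using c by (simp add: coordinate_manifold_def)
    then have W: "openin (top_of_set N) W" and "open (x ` W)" by (auto simp: is_chart_def)
    then show "open W" "W \<subseteq> N" "open (x ` W)" "inj_on x W"
      using openin_open_trans[OF W o] is_chart_inj[OF ch] openin_imp_subset[OF W] by auto
    show "smooth_on W x" "smooth_on (x ` W) (inv_into W x)"
      using c by (simp_all add: coordinate_manifold_def)
  qed
  \<comment> \<open>The definition of \<open>isometry\<close> uses \<open>inv_into\<close>; on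
    \<open>N'\<close> it is the smooth map \<open>\<Psi>\<close>.\<close>
  have inv: "inv_into N \<Phi> p = \<Psi> p" if "p \<in> N'" for p
    using that \<Psi>\<Phi> \<Phi>\<Psi> \<Psi>(2) by (metis inj_onI inv_into_f_f)
  have "homeomorphic_maps (top_of_set N) (top_of_set N') \<Phi> \<Psi>"
    using smooth_on_continuous[OF \<Phi>(1)] smooth_on_continuous[OF \<Psi>(1)] \<Phi>(2) \<Psi>(2) \<Psi>\<Phi> \<Phi>\<Psi>
    by (auto simp: homeomorphic_maps_def)
  then have "homeomorphic_map (top_of ?M) (top_of ?M') \<Phi>"
    by (auto simp: coordinate_manifold_def homeomorphic_map_maps)
  moreover have "smooth_on (x ` (W \<inter> \<Phi> -` W')) (x' \<circ> \<Phi> \<circ> inv_into W x) \<and>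
        smooth_on (x' ` (\<Phi> ` W \<inter> W')) (x \<circ> inv_into (topspace (top_of ?M)) \<Phi> \<circ> inv_into W' x') \<and>
        (\<forall>q\<in>x ` (W \<inter> \<Phi> -` W').
           metric ?M (W, x) q = pullback (x' \<circ> \<Phi> \<circ> inv_into W x) (metric ?M' (W', x')) q)"
    if c: "(W, x) \<in> atlas ?M" and c': "(W', x') \<in> atlas ?M'" for W x W' x'
  proof (intro conjI ballI)
    note C = chartD[OF c N] and C' = chartD[OF c' N']
    have \<Phi>W: "smooth_on W \<Phi>" using \<Phi>(1) C(2) by (rule smooth_on_subset)
    note E = smooth_in_charts[OF C(1) C'(1) C(3,4,6) C'(5) \<Phi>W]
    note E' = smooth_in_charts[OF C'(1) C(1) C'(3,4,6) C(5) smooth_on_subset[OF \<Psi>(1) C'(2)]]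
    show "smooth_on (x ` (W \<inter> \<Phi> -` W')) (x' \<circ> \<Phi> \<circ> inv_into W x)" by (rule E(2))
    have eq: "\<Phi> ` W \<inter> W' = W' \<inter> \<Psi> -` W"
      using C(2) C'(2) \<Psi>\<Phi> \<Phi>\<Psi> by (auto simp: image_iff) force+
    have "smooth_on (x' ` (W' \<inter> \<Psi> -` W)) (x \<circ> inv_into N \<Phi> \<circ> inv_into W' x') \<longleftrightarrow>
        smooth_on (x' ` (W' \<inter> \<Psi> -` W)) (x \<circ> \<Psi> \<circ> inv_into W' x')"
      by (rule smooth_on_cong[OF E'(1)]) (use inv C' in \<open>auto simp: inv_into_f_f\<close>)
    then show "smooth_on (x' ` (\<Phi> ` W \<inter> W')) (x \<circ> inv_into (topspace (top_of ?M)) \<Phi> \<circ> inv_into W' x')"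
      unfolding eq using E'(2) by (simp add: coordinate_manifold_def)
    fix q assume q: "q \<in> x ` (W \<inter> \<Phi> -` W')"
    let ?i = "inv_into W x" and ?i' = "inv_into W' x'"
    have qW: "q \<in> x ` W" and iq: "?i q \<in> W" "\<Phi> (?i q) \<in> W'" using q C(4) by (auto simp: inv_into_f_f)
    have di: "?i differentiable (at q)" using C(6) qW by (rule smooth_on_differentiable)
    have "metric ?M (W, x) q = pullback ?i h q" by (simp add: coordinate_manifold_def)
    also have "\<dots> = pullback ?i (pullback \<Phi> h') q"
      by (rule pullback_cong[OF C(3) qW]) (use h iq C(2) in auto)
    also have "\<dots> = pullback (\<Phi> \<circ> ?i) h' q"
      by (rule pullback_compose[OF di smooth_on_differentiable[OF \<Phi>W iq(1)]])
    \<comment> \<open>The chart \<open>x'\<close> followed by its inverse is inserted; this leaves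
      the map unchanged on the open set where \<open>\<Phi>\<close> lands in
      \<open>W'\<close>.\<close>
    also have "\<dots> = pullback (?i' \<circ> (x' \<circ> \<Phi> \<circ> ?i)) h' q"
      by (rule pullback_cong[OF E(1) q]) (use C(4) C'(4) in \<open>auto simp: inv_into_f_f\<close>)
    also have "\<dots> = pullback (x' \<circ> \<Phi> \<circ> ?i) (pullback ?i' h') q"
      using iq(2) by (intro pullback_compose[symmetric] smooth_on_differentiable[OF E(2) q]
          smooth_on_differentiable[OF C'(6)]) auto
    finally show "metric ?M (W, x) q = pullback (x' \<circ> \<Phi> \<circ> ?i) (metric ?M' (W', x')) q"
      by (simp add: coordinate_manifold_def)
  qed
  ultimately show ?thesis unfolding isometry_def by blast
qed

lemma (in adapted_isometry) isometric_penrose_coordinates: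
  "isometric (coordinate_manifold {q. axis u (q $ u) \<in> U} (penrose_metric u v G))
     (coordinate_manifold {q. axis u (q $ u) \<in> U'} (penrose_metric u v G'))"
  using isometry_coordinate_manifold[OF open_N open_N' smooth_\<Phi> \<Phi>_in smooth_\<Psi> \<Psi>_in \<Psi>_\<Phi> \<Phi>_\<Psi>
      penrose_metric_pullback]
  unfolding isometric_def N_def N'_def by blast

section \<open>From the manifolds to adapted coordinates\<close>

lemma lorentzian_manifold_atlas:
  assumes M: "lorentzian_manifold M" and c: "(W, x) \<in> atlas M"
  shows "is_chart (top_of M) (W, x)" "smooth_on (x ` W) (metric M (W, x))"
    and "q \<in> x ` W \<Longrightarrow> transpose (metric M (W, x) q) = metric M (W, x) q"
proof -
  show "is_chart (top_of M) (W, x)"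
    using M c by (simp add: lorentzian_manifold_def smooth_manifold_def)
  have "\<forall>(W, x)\<in>atlas M. smooth_on (x ` W) (metric M (W, x)) \<and>
        (\<forall>q\<in>x ` W. lorentzian_form (metric M (W, x) q))"
    using M by (simp add: lorentzian_manifold_def)
  then have *: "smooth_on (x ` W) (metric M (W, x)) \<and> (\<forall>q\<in>x ` W. lorentzian_form (metric M (W, x) q))"
    using c by blast
  then show "smooth_on (x ` W) (metric M (W, x))" ..
  show "transpose (metric M (W, x) q) = metric M (W, x) q" if "q \<in> x ` W"
    using * that lorentzian_form_symmetric by blast
qed

lemma tubular_neighbourhoodD:
  assumes "lorentzian_manifold M" "tubular_neighbourhood M \<gamma> I T"
  shows "openin (top_of M) T" "\<gamma> ` I \<subseteq> T"
proof -
  obtain x where "(T, x) \<in> atlas M" "\<forall>s\<in>I. \<gamma> s \<in> T"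
    using assms(2) unfolding tubular_neighbourhood_def by blast
  then show "openin (top_of M) T" "\<gamma> ` I \<subseteq> T"
    using lorentzian_manifold_atlas(1)[OF assms(1)] by (auto simp: is_chart_def)
qed

text \<open>The Penrose limits are computed in arbitrary adapted charts covering corresponding
  segments of the two curves. That correspondence makes the axis segments of the two chart images
  match under the coordinate form of \<open>f\<close>, as \<open>adapted_isometry\<close>
  requires.\<close>

theorem theorem2:
  fixes M :: "('a, 'n::finite) metric_manifold" and M' :: "('b, 'n) metric_manifold"
    and \<gamma> :: "real \<Rightarrow> 'a" and \<gamma>' :: "real \<Rightarrow> 'b" and I I' :: "real set"
    and T :: "'a set" and T' :: "'b set" and f :: "'a \<Rightarrow> 'b"
    and u v :: 'n
    and W :: "'a set" and x :: "'a \<Rightarrow> real^'n"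
    and W' :: "'b set" and x' :: "'b \<Rightarrow> real^'n"
  assumes "lorentzian_manifold M" and "lorentzian_manifold M'"
    and "null_geodesic M \<gamma> I" and "null_geodesic M' \<gamma>' I'"
    and "tubular_neighbourhood M \<gamma> I T" and "tubular_neighbourhood M' \<gamma>' I' T'"
    and "isometry (open_submanifold M T) (open_submanifold M' T') f"
    and "f ` (\<gamma> ` I) = \<gamma>' ` I'"
    and "adapted_chart M \<gamma> I u v (W, x)" and "adapted_chart M' \<gamma>' I' u v (W', x')"
    and "f ` (\<gamma> ` I \<inter> W) = \<gamma>' ` I' \<inter> W'"
  shows "isometric (penrose_limit M u v (W, x)) (penrose_limit M' u v (W', x'))"
proof -
  note M = assms(1) and M' = assms(2)
  have c: "(W, x) \<in> atlas M" and uv: "u \<noteq> v"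
    and ax: "x ` (\<gamma> ` I \<inter> W) = x ` W \<inter> range (axis u)"
    and ad: "adapted_form u v (x ` W) (metric M (W, x))"
    using assms(9) by (simp_all add: adapted_chart_def)
  have c': "(W', x') \<in> atlas M'"
    and ax': "x' ` (\<gamma>' ` I' \<inter> W') = x' ` W' \<inter> range (axis u)"
    and ad': "adapted_form u v (x' ` W') (metric M' (W', x'))"
    using assms(10) by (simp_all add: adapted_chart_def)
  note A = lorentzian_manifold_atlas[OF M] and A' = lorentzian_manifold_atlas[OF M']
  note T = tubular_neighbourhoodD[OF M assms(5)] and T' = tubular_neighbourhoodD[OF M' assms(6)]
  have sm: "smooth_manifold M" "smooth_manifold M'" using M M' by (simp_all add: lorentzian_manifold_def)
  \<comment> \<open>\<open>isometry\<close> provides information only for charts whose domains lie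
    in \<open>T\<close> and \<open>T'\<close>.\<close>
  define V V' where "V = W \<inter> T" and "V' = W' \<inter> T'"
  have cV: "(V, x) \<in> atlas M" and cV': "(V', x') \<in> atlas M'"
    unfolding V_def V'_def by (rule atlas_restrict[OF sm(1) c T(1)], rule atlas_restrict[OF sm(2) c' T'(1)])
  have ch: "is_chart (top_of M) (W, x)" "is_chart (top_of M') (W', x')"
    "is_chart (top_of M) (V, x)" "is_chart (top_of M') (V', x')"
    by (fact A(1)[OF c] A'(1)[OF c'] A(1)[OF cV] A'(1)[OF cV'])+
  note inj = is_chart_inj[OF ch(3)] is_chart_inj[OF ch(4)]
  have oV: "openin (top_of M) V" "openin (top_of M') V'" using ch by (simp_all add: is_chart_def)
  have tT: "topspace (top_of (open_submanifold M T)) = T"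
    using openin_subset[OF T(1)] by (auto simp: open_submanifold_def)
  have fh: "homeomorphic_map (subtopology (top_of M) T) (subtopology (top_of M') T') f"
    using assms(7) by (simp add: isometry_def open_submanifold_def)
  have injT: "inj_on f T"
    using homeomorphic_imp_injective_map[OF fh] openin_subset[OF T(1)] by (simp add: Int_absorb1)
  \<comment> \<open>The largest sets on which \<open>f\<close> and its inverse can be read in both
    restricted charts.\<close>
  define D D' where "D = x ` (V \<inter> f -` V')" and "D' = x' ` (f ` V \<inter> V')"
  define F F' where "F = x' \<circ> f \<circ> inv_into V x" and "F' = x \<circ> inv_into T f \<circ> inv_into V' x'"
  have "(V, x) \<in> atlas (open_submanifold M T)" "(V', x') \<in> atlas (open_submanifold M' T')"
    using cV cV' by (simp_all add: open_submanifold_def V_def V'_def)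
  then have iso_charts: "smooth_on (x ` (V \<inter> f -` V')) (x' \<circ> f \<circ> inv_into V x) \<and>
      smooth_on (x' ` (f ` V \<inter> V')) (x \<circ> inv_into (topspace (top_of (open_submanifold M T))) f \<circ> inv_into V' x') \<and>
      (\<forall>q\<in>x ` (V \<inter> f -` V'). metric (open_submanifold M T) (V, x) q =
         pullback (x' \<circ> f \<circ> inv_into V x) (metric (open_submanifold M' T') (V', x')) q)"
    using assms(7) unfolding isometry_def by blast
  have iso: "smooth_on D F" "smooth_on D' F'"
      "\<And>q. q \<in> D \<Longrightarrow> metric M (V, x) q = pullback F (metric M' (V', x')) q"
    using iso_charts unfolding D_def D'_def F_def F'_def tT by (auto simp: open_submanifold_def)
  have F: "F (x p) = x' (f p)" if "p \<in> V" for p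
    using that inj by (simp add: F_def)
  have F': "F' (x' (f p)) = x p" if "p \<in> V" "f p \<in> V'" for p
    using that inj injT by (simp add: F'_def V_def)
  have D_iff: "q \<in> D \<longleftrightarrow> (\<exists>p\<in>V. f p \<in> V' \<and> q = x p)" for q by (auto simp: D_def)
  have D'_iff: "q \<in> D' \<longleftrightarrow> (\<exists>p\<in>V. f p \<in> V' \<and> q = x' (f p))" for q by (auto simp: D'_def)
  have "openin (top_of M) (V \<inter> f -` V')"
  proof -
    have "openin (subtopology (top_of M') T') V'"
      using oV(2) by (metis V'_def inf.cobounded2 inf.absorb_iff1 openin_subtopology)
    \<comment> \<open>Continuity of \<open>f\<close> gives openness relative to \<open>T\<close>,
      which is itself open in \<open>M\<close>.\<close>
    then have "openin (subtopology (top_of M) T) {p \<in> topspace (subtopology (top_of M) T). f p \<in> V'}"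
      using homeomorphic_imp_continuous_map[OF fh] by (simp add: continuous_map)
    then have "openin (top_of M) {p \<in> topspace (subtopology (top_of M) T). f p \<in> V'}"
      using T(1) openin_trans_full by blast
    from openin_Int[OF oV(1) this] show ?thesis
      by (rule back_subst[where P = "openin _"])
        (use openin_subset[OF T(1)] in \<open>auto simp: V_def\<close>)
  qed
  then have oD: "open D" unfolding D_def by (intro is_chart_open_image[OF ch(3)]) auto
  have "openin (top_of M') (f ` V)"
  proof -
    have "openin (subtopology (top_of M) T) V"
      using oV(1) by (metis V_def inf.cobounded2 inf.absorb_iff1 openin_subtopology)
    then have "openin (subtopology (top_of M') T') (f ` V)"
      using homeomorphic_imp_open_map[OF fh] by (simp add: open_map_def)
    then show ?thesis using T'(1) openin_trans_full by blast
  qed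
  then have oD': "open D'"
    unfolding D'_def using oV(2) by (intro is_chart_open_image[OF ch(4)]) auto
  interpret adapted_isometry u v "x ` W" "x' ` W'" D D' "metric M (W, x)" "metric M' (W', x')" F F'
  proof
    show "u \<noteq> v" by (rule uv)
    show "open (x ` W)" "open (x' ` W')" using ch by (simp_all add: is_chart_def)
    show "open D" "open D'" by (fact oD oD')+
    show "D \<subseteq> x ` W" "D' \<subseteq> x' ` W'" by (auto simp: D_def D'_def V_def V'_def)
    show "F q \<in> D'" "F' (F q) = q" if "q \<in> D" for q
      using that F F' by (auto simp: D_iff D'_iff)
    show "F' q \<in> D" "F (F' q) = q" if "q \<in> D'" for q
      using that F F' by (auto simp: D_iff D'_iff)
    show "smooth_on D F" "smooth_on D' F'" by (fact iso)+
    show "continuous_on (x ` W) (metric M (W, x))" "continuous_on (x' ` W') (metric M' (W', x'))"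
      by (fact smooth_on_continuous[OF A(2)[OF c]] smooth_on_continuous[OF A'(2)[OF c']])+
    show "transpose (metric M (W, x) q) = metric M (W, x) q" if "q \<in> x ` W" for q
      by (rule A(3)[OF c that])
    show "transpose (metric M' (W', x') q) = metric M' (W', x') q" if "q \<in> x' ` W'" for q
      by (rule A'(3)[OF c' that])
    show "adapted_form u v (x ` W) (metric M (W, x))" "adapted_form u v (x' ` W') (metric M' (W', x'))"
      by (fact ad ad')+
    show "metric M (W, x) q = pullback F (metric M' (W', x')) q" if q: "q \<in> D" for q
    proof -
      obtain p where p: "p \<in> V" "f p \<in> V'" "q = x p" using q D_iff by blast
      \<comment> \<open>The identity is known for the restricted charts and is carried over to the
        original ones on both sides.\<close>
      have "metric M (W, x) q = metric M (V, x) q"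
        unfolding V_def by (rule metric_restrict[OF M c T(1), symmetric]) (use p V_def in auto)
      also have "\<dots> = pullback F (metric M' (V', x')) q" by (rule iso(3)[OF q])
      also have "\<dots> = pullback F (metric M' (W', x')) q"
      proof (rule pullback_cong[OF oD q])
        show "metric M' (V', x') (F q) = metric M' (W', x') (F q)"
          unfolding V'_def by (rule metric_restrict[OF M' c' T'(1)]) (use p F V'_def in auto)
      qed simp
      finally show ?thesis .
    qed
    show "axis u s \<in> D \<and> F (axis u s) \<in> range (axis u)" if s: "axis u s \<in> x ` W" for s
    proof -
      \<comment> \<open>A point of the axis comes from a point \<open>p\<close> of the curve. The
        tubular neighbourhoods contain the curves, and the matching of segments puts
        \<open>f p\<close> into \<open>W'\<close>, so the point lies in \<open>D\<close>.\<close>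
      have "axis u s \<in> x ` (\<gamma> ` I \<inter> W)" using s ax by blast
      then obtain p where p: "p \<in> \<gamma> ` I \<inter> W" "axis u s = x p" by blast
      then have fp: "f p \<in> \<gamma>' ` I' \<inter> W'" using assms(11) by blast
      then have "p \<in> V" "f p \<in> V'" using p T(2) T'(2) by (auto simp: V_def V'_def)
      moreover have "x' (f p) \<in> range (axis u)" using fp ax' by blast
      ultimately show ?thesis using p F D_iff by auto
    qed
    show "axis u s \<in> D' \<and> F' (axis u s) \<in> range (axis u)" if s: "axis u s \<in> x' ` W'" for s
    proof -
      have "axis u s \<in> x' ` (\<gamma>' ` I' \<inter> W')" using s ax' by blast
      then obtain p where p: "p \<in> \<gamma> ` I \<inter> W" "axis u s = x' (f p)"
        unfolding assms(11)[symmetric] by blast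
      then have "f p \<in> \<gamma>' ` I' \<inter> W'" using assms(11) by blast
      then have "p \<in> V" "f p \<in> V'" using p T(2) T'(2) by (auto simp: V_def V'_def)
      moreover have "x p \<in> range (axis u)" using p ax by blast
      ultimately show ?thesis using p F' D'_iff by auto
    qed
  qed
  show ?thesis using isometric_penrose_coordinates by (simp add: penrose_limit_def)
qed

end
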